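(* Let $p\ge2$ be fixed. There is a constant $C_p$ (depending only on $p$) such that for all $n\ge2$ and all integers $0 \le s \le n/2$, \[ R(n,s,p) ~\le~ 2^{C_p\frac{n}{\log n}} \cdot r(n,s,p). \]
   Context: With respect to the uniform measure on $\{0,1\}^n$, $\|f\|_q=(\mathbb{E}|f|^q)^{1/q}$. A homogeneous polynomial of degree $s$ is a linear combination of Walsh characters $W_\alpha(y)=(-1)^{\sum\alpha_iy_i}$ with $|\alpha|=s$. $R(n,s,p)$ is the maximum of $\frac{\|f\|_p^p}{\|f\|_2^p}$ over nonzero homogeneous polynomials $f$ of degree $s$ on $\{0,1\}^n$, and $r(n,s,p)=\frac{\|K_s\|_p^p}{\|K_s\|_2^p}$ where $K_s=\sum_{|\alpha|=s}W_\alpha$ is the Krawchouk polynomial. *)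

theory Defs
  imports "HOL-Probability.Probability"
begin

text \<open>
  The dimension \<open>n\<close> varies inside the statements, so the points of \<open>{0,1}\<^sup>n\<close> are extensional
  functions on \<open>{..<n}\<close>, and a function on the cube is a function \<open>(nat \<Rightarrow> nat) \<Rightarrow> real\<close>
  of which only the values on \<open>cube n\<close> matter.
\<close>

definition cube :: "nat \<Rightarrow> (nat \<Rightarrow> nat) set" where
  "cube n = {..<n} \<rightarrow>\<^sub>E {0, 1}"

definition weight :: "nat \<Rightarrow> (nat \<Rightarrow> nat) \<Rightarrow> nat" where
  "weight n \<alpha> = (\<Sum>i<n. \<alpha> i)"

definition walsh :: "nat \<Rightarrow> (nat \<Rightarrow> nat) \<Rightarrow> (nat \<Rightarrow> nat) \<Rightarrow> real" where
  "walsh n \<alpha> y = (-1) ^ (\<Sum>i<n. \<alpha> i * y i)"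

definition cube_norm :: "nat \<Rightarrow> real \<Rightarrow> ((nat \<Rightarrow> nat) \<Rightarrow> real) \<Rightarrow> real" where
  "cube_norm n q f =
     (measure_pmf.expectation (pmf_of_set (cube n)) (\<lambda>y. \<bar>f y\<bar> powr q)) powr (1 / q)"

definition homogeneous_poly :: "nat \<Rightarrow> nat \<Rightarrow> ((nat \<Rightarrow> nat) \<Rightarrow> real) \<Rightarrow> bool" where
  "homogeneous_poly n s f \<longleftrightarrow>
     (\<exists>c. \<forall>y\<in>cube n. f y = (\<Sum>\<alpha> | \<alpha> \<in> cube n \<and> weight n \<alpha> = s. c \<alpha> * walsh n \<alpha> y))"

definition krawchouk :: "nat \<Rightarrow> nat \<Rightarrow> (nat \<Rightarrow> nat) \<Rightarrow> real" where
  "krawchouk n s y = (\<Sum>\<alpha> | \<alpha> \<in> cube n \<and> weight n \<alpha> = s. walsh n \<alpha> y)"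

definition moment_ratio :: "nat \<Rightarrow> real \<Rightarrow> ((nat \<Rightarrow> nat) \<Rightarrow> real) \<Rightarrow> real" where
  "moment_ratio n p f = cube_norm n p f powr p / cube_norm n 2 f powr p"

text \<open>
  The supremum below is a maximum for \<open>s \<le> n\<close> and \<open>p > 0\<close>: the ratio is invariant under
  scaling, and the nonzero polynomials of degree \<open>s\<close> form a finite-dimensional space with
  compact unit sphere.
\<close>

definition max_ratio :: "nat \<Rightarrow> nat \<Rightarrow> real \<Rightarrow> real" where
  "max_ratio n s p =
     (SUP f \<in> {f. homogeneous_poly n s f \<and> (\<exists>y\<in>cube n. f y \<noteq> 0)}. moment_ratio n p f)"

definition krawchouk_ratio :: "nat \<Rightarrow> nat \<Rightarrow> real \<Rightarrow> real" where
  "krawchouk_ratio n s p = moment_ratio n p (krawchouk n s)"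

lemma finite_cube: "finite (cube n)"
  by (simp add: cube_def finite_PiE)

lemma card_cube: "card (cube n) = 2 ^ n"
  by (simp add: cube_def card_PiE numeral_2_eq_2)

lemma cube_nonempty: "cube n \<noteq> {}"
  using card_cube[of n] by auto

lemma cube_norm_eq_sum:
  "cube_norm n q f = ((\<Sum>y\<in>cube n. \<bar>f y\<bar> powr q) / 2 ^ n) powr (1 / q)"
  by (simp add: cube_norm_def integral_pmf_of_set finite_cube cube_nonempty card_cube)

end

theory Submission imports Defs "HOL-Real_Asymp.Real_Asymp" begin

text \<open>
  Suppose \<open>E |A + t B \<xi>|\<^sup>p \<le> L (A\<^sup>2 + B\<^sup>2)\<close> to the power \<open>p / 2\<close>, for a random sign \<open>\<xi>\<close>. Since
  \<open>p \<ge> 2\<close>, Minkowski's inequality tensorizes this to the noise operator that multiplies the degree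
  \<open>s\<close> part by \<open>t\<^sup>s\<close>, so the moment ratio of every homogeneous polynomial of degree \<open>s\<close> is at most
  \<open>L\<^sup>n\<close> divided by the \<open>p\<close>-th power of \<open>t\<^sup>s\<close>.

  Conversely, let \<open>(a, b)\<close> with \<open>b\<^sup>2 = x = 1 - a\<^sup>2\<close> be extremal in the two-point inequality. The
  product of the \<open>a + t b \<xi>\<^sub>i\<close> has \<open>p\<close>-th moment exactly \<open>L\<^sup>n\<close> and expands into Krawchouk polynomials.
  The upper bound, applied to each of them, and Hoeffding's inequality for the binomial weights show
  that the degrees far from \<open>n x\<close> contribute little; hence some \<open>K\<^sub>k\<close> with \<open>k\<close> within
  \<open>W\<close> of \<open>n x\<close> attains the upper bound up to a factor polynomial in \<open>n\<close>. Every
  \<open>x \<in> (0, 1/2]\<close> occurs as an extremal point for some \<open>t\<close>, and passing from degree \<open>k\<close> to a nearby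
  degree costs at most \<open>n\<close> to the power \<open>O(W)\<close>, which is affordable for \<open>W\<close> of order \<open>n\<close> to the
  power \<open>3/4\<close>.
\<close>

section \<open>The two-point inequality\<close>

text \<open>Both sides agree at 0, and the derivatives compare because \<open>cosh\<close> is
  increasing on the nonnegative reals and \<open>w \<le> q * w\<close>.\<close>

lemma sinh_mult_ge:
  fixes q z :: real
  assumes "q \<ge> 1" "z \<ge> 0"
  shows "q * sinh z \<le> sinh (q * z)"
proof -
  have "(\<lambda>z. sinh (q * z) - q * sinh z) 0 \<le> (\<lambda>z. sinh (q * z) - q * sinh z) z"
  proof (rule DERIV_nonneg_imp_nondecreasing[OF assms(2)])
    fix w :: real assume w: "0 \<le> w" "w \<le> z"
    have "w \<le> q * w" using w assms by (simp add: mult_le_cancel_right1)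
    hence "cosh w \<le> cosh (q * w)" using w by (subst cosh_real_nonneg_le_iff) auto
    moreover have "((\<lambda>z. sinh (q * z) - q * sinh z) has_real_derivative
        (q * cosh (q * w) - q * cosh w)) (at w)"
      by (auto intro!: derivative_eq_intros)
    ultimately show "\<exists>y. ((\<lambda>z. sinh (q * z) - q * sinh z) has_real_derivative y) (at w) \<and> 0 \<le> y"
      using assms by (intro exI[of _ "q * cosh (q * w) - q * cosh w"]) auto
  qed
  thus ?thesis by simp
qed

text \<open>With \<open>z = ln ((1 + u) / (1 - u))\<close> this is \<open>sinh_mult_ge\<close>
  cleared of denominators. It is the form in which the numerator of the derivative of
  \<open>tilt q\<close> is seen to be nonnegative.\<close>

lemma powr_square_diff_ge:
  fixes q u :: real
  assumes "q \<ge> 1" "0 < u" "u < 1"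
  shows "4 * q * u * ((1 + u) powr (q - 1) * (1 - u) powr (q - 1))
    \<le> ((1 + u) powr q)\<^sup>2 - ((1 - u) powr q)\<^sup>2"
proof -
  define A B where "A = (1 + u) powr q" and "B = (1 - u) powr q"
  define z where "z = ln (1 + u) - ln (1 - u)"
  have pos: "A > 0" "B > 0" "z \<ge> 0" using assms by (auto simp: A_def B_def z_def)
  have "exp (q * z) = A / B" "exp (- (q * z)) = B / A"
    using assms by (simp_all add: A_def B_def z_def powr_def right_diff_distrib exp_diff)
  hence s1: "sinh (q * z) = (A / B - B / A) / 2" by (simp add: sinh_field_def)
  have "exp z = (1 + u) / (1 - u)" "exp (- z) = (1 - u) / (1 + u)"
    using assms by (simp_all add: z_def exp_diff)
  hence s2: "sinh z = ((1 + u) / (1 - u) - (1 - u) / (1 + u)) / 2" by (simp add: sinh_field_def)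
  also have "(1 + u) / (1 - u) - (1 - u) / (1 + u) = 4 * u / ((1 + u) * (1 - u))"
    using assms by (subst diff_frac_eq) (auto simp: algebra_simps)
  also have "4 * u / ((1 + u) * (1 - u)) / 2 = 2 * u / ((1 + u) * (1 - u))"
    by simp
  finally have s2: "sinh z = 2 * u / ((1 + u) * (1 - u))" .
  have "q * (2 * u / ((1 + u) * (1 - u))) \<le> (A / B - B / A) / 2"
    using sinh_mult_ge[OF assms(1) pos(3)] s1 s2 by simp
  also have "\<dots> = (A\<^sup>2 - B\<^sup>2) / (2 * A * B)" using pos by (simp add: field_simps power2_eq_square)
  finally have "q * (2 * u / ((1 + u) * (1 - u))) * (2 * A * B) \<le> A\<^sup>2 - B\<^sup>2"
    using pos by (simp add: pos_le_divide_eq)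
  moreover have "A = (1 + u) * (1 + u) powr (q - 1)" "B = (1 - u) * (1 - u) powr (q - 1)"
    using assms by (simp_all add: A_def B_def powr_diff)
  ultimately show ?thesis unfolding A_def[symmetric] B_def[symmetric]
    using assms by (simp add: mult_ac)
qed

lemma continuous_on_powr_const:
  fixes f :: "'a::topological_space \<Rightarrow> real"
  assumes "continuous_on S f" "\<And>x. x \<in> S \<Longrightarrow> f x \<ge> 0" "q > 0"
  shows "continuous_on S (\<lambda>x. f x powr q)"
  using assms by (intro continuous_on_powr' continuous_intros) auto

text \<open>
  The squared noise parameter \<open>t\<^sup>2\<close> for which \<open>u = t B / A\<close> is a critical point of the two-point
  ratio bounded in \<open>two_point_bound\<close> below, where \<open>q = p - 1\<close>.
  In the coordinate \<open>u = tanh z\<close> it equals \<open>tanh z / tanh (q z)\<close>, so it increases with \<open>u\<close> because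
  \<open>sinh (2 q z) \<ge> q sinh (2 z)\<close>; hence the critical point is unique.
\<close>

definition tilt :: "real \<Rightarrow> real \<Rightarrow> real" where
  "tilt q u = u * ((1 + u) powr q + (1 - u) powr q) / ((1 + u) powr q - (1 - u) powr q)"

lemma powr_one_minus_less:
  fixes q u :: real
  assumes "q > 0" "0 < u" "u \<le> 1"
  shows "(1 - u) powr q < (1 + u) powr q"
  using assms by (intro powr_less_mono2) auto

lemma tilt_mono:
  fixes q u v :: real
  assumes q: "q \<ge> 1" and uv: "0 < u" "u \<le> v" "v \<le> 1"
  shows "tilt q u \<le> tilt q v"
proof (rule DERIV_nonneg_imp_increasing_open[OF uv(2)])
  fix w assume w: "u < w" "w < v"
  hence w01: "0 < w" "w < 1" using uv by auto
  define A B A1 B1 where "A = (1 + w) powr q" and "B = (1 - w) powr q"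
    and "A1 = (1 + w) powr (q - 1)" and "B1 = (1 - w) powr (q - 1)"
  have AB: "B < A" unfolding A_def B_def using q w01 by (intro powr_one_minus_less) auto
  have e: "A = (1 + w) * A1" "B = (1 - w) * B1"
    using w01 by (simp_all add: A_def B_def A1_def B1_def powr_diff)
  have dA: "((\<lambda>w. (1 + w) powr q) has_real_derivative q * A1) (at w)"
    using DERIV_fun_powr[of "\<lambda>w. 1 + w" 1 w q] w01
    by (auto simp: A1_def intro!: derivative_eq_intros)
  have dB: "((\<lambda>w. (1 - w) powr q) has_real_derivative - (q * B1)) (at w)"
    using DERIV_fun_powr[of "\<lambda>w. 1 - w" "-1" w q] w01
    by (auto simp: B1_def intro!: derivative_eq_intros)
  define D where "D = ((A + B + w * (q * A1 - q * B1)) * (A - B) - w * (A + B) * (q * A1 + q * B1))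
    / ((A - B) * (A - B))"
  have "(tilt q has_real_derivative D) (at w)"
    using DERIV_divide[OF DERIV_mult[OF DERIV_ident DERIV_add[OF dA dB]] DERIV_diff[OF dA dB]] AB
    unfolding tilt_def[abs_def] D_def A_def B_def by (simp add: algebra_simps)
  moreover have "D \<ge> 0"
  proof -
    have "4 * q * w * (A1 * B1) \<le> A\<^sup>2 - B\<^sup>2"
      unfolding A_def B_def A1_def B1_def using powr_square_diff_ge[OF q w01] .
    moreover have "(A + B + w * (q * A1 - q * B1)) * (A - B) - w * (A + B) * (q * A1 + q * B1)
      = A\<^sup>2 - B\<^sup>2 - 4 * q * w * (A1 * B1)"
      unfolding e by (simp add: algebra_simps power2_eq_square)
    ultimately show ?thesis unfolding D_def by simp
  qed
  ultimately show "\<exists>y. (tilt q has_real_derivative y) (at w) \<and> 0 \<le> y" by blast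
next
  have "(1 + w) powr q - (1 - w) powr q \<noteq> 0" if "w \<in> {u..v}" for w
    using powr_one_minus_less[of q w] that uv q by auto
  thus "continuous_on {u..v} (tilt q)"
    unfolding tilt_def[abs_def] using uv q by (intro continuous_on_powr_const continuous_intros) auto
qed

lemma tilt_pos:
  assumes "q > 0" "0 < u" "u \<le> 1"
  shows "tilt q u > 0"
  using assms powr_one_minus_less[OF assms] unfolding tilt_def
  by (intro divide_pos_pos mult_pos_pos add_pos_nonneg) auto

text \<open>Monotonicity, together with \<open>tilt q 1 = 1\<close>.\<close>

lemma tilt_le_1:
  assumes "q \<ge> 1" "0 < u" "u \<le> 1"
  shows "tilt q u \<le> 1"
  using tilt_mono[OF assms(1,2,3)] by (simp add: tilt_def)

text \<open>For A = 1 and B = w / t with \<open>T\<close> = t^2, the sum A^2 + B^2 is (T + w^2) / T,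
  so the quotient of \<open>N w\<close> and \<open>(T + w\<^sup>2) powr (p / 2)\<close> is the
  two-point ratio up to a constant. Its logarithm \<open>G\<close> has a derivative with the sign of
  \<open>T - tilt (p - 1) w\<close>; by \<open>tilt_mono\<close>, \<open>G\<close> increases up to
  \<open>v\<close> and decreases afterwards.\<close>

lemma two_point_critical_max:
  fixes p u v :: real
  assumes p: "p \<ge> 2" and u: "0 \<le> u" "u \<le> 1" and v: "0 < v" "v \<le> 1"
  shows "((1 + u) powr p + (1 - u) powr p) * (tilt (p - 1) v + v\<^sup>2) powr (p / 2)
    \<le> ((1 + v) powr p + (1 - v) powr p) * (tilt (p - 1) v + u\<^sup>2) powr (p / 2)"
proof -
  define T where "T = tilt (p - 1) v"
  have T: "T > 0" unfolding T_def using p v by (intro tilt_pos) auto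
  have Tw: "T + w\<^sup>2 > 0" for w using T by (simp add: add_pos_nonneg)
  define N where "N = (\<lambda>w::real. (1 + w) powr p + (1 - w) powr p)"
  have N: "N w > 0" if "0 \<le> w" for w unfolding N_def using that by (intro add_pos_nonneg) auto
  define G where "G = (\<lambda>w. ln (N w) - p / 2 * ln (T + w\<^sup>2))"
  have cont: "continuous_on {a..b} G" if "0 \<le> a" "b \<le> 1" for a b
  proof -
    have "continuous_on {a..b} N"
      unfolding N_def using p that by (intro continuous_on_powr_const continuous_intros) auto
    moreover have "N w \<noteq> 0" if "w \<in> {a..b}" for w using N[of w] that \<open>0 \<le> a\<close> by auto
    moreover have "T + w\<^sup>2 \<noteq> 0" for w using Tw[of w] by auto
    ultimately show ?thesis unfolding G_def by (intro continuous_intros) auto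
  qed
  define G' where "G' = (\<lambda>w. p * ((1 + w) powr (p - 1) - (1 - w) powr (p - 1)) *
      (T - tilt (p - 1) w) / (N w * (T + w\<^sup>2)))"
  have der: "(G has_real_derivative G' w) (at w)" if w: "0 < w" "w < 1" for w
  proof -
    define A B where "A = (1 + w) powr (p - 1)" and "B = (1 - w) powr (p - 1)"
    have AB: "B < A" unfolding A_def B_def using p w by (intro powr_one_minus_less) auto
    have e: "N w = (1 + w) * A + (1 - w) * B"
      using w by (simp add: A_def B_def N_def powr_diff)
    have dA: "((\<lambda>w. (1 + w) powr p) has_real_derivative p * A) (at w)"
      using DERIV_fun_powr[of "\<lambda>w. 1 + w" 1 w p] w
      by (auto simp: A_def intro!: derivative_eq_intros)
    have dB: "((\<lambda>w. (1 - w) powr p) has_real_derivative - (p * B)) (at w)"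
      using DERIV_fun_powr[of "\<lambda>w. 1 - w" "-1" w p] w
      by (auto simp: B_def intro!: derivative_eq_intros)
    have dN: "(N has_real_derivative (p * A - p * B)) (at w)"
      unfolding N_def using DERIV_add[OF dA dB] by simp
    have d1: "((\<lambda>w. ln (N w)) has_real_derivative (1 / N w * (p * A - p * B))) (at w)"
      using DERIV_chain2[OF DERIV_ln_divide dN] N[of w] w by simp
    have d0: "((\<lambda>w. T + w\<^sup>2) has_real_derivative 2 * w) (at w)"
      by (auto intro!: derivative_eq_intros)
    have d2: "((\<lambda>w. ln (T + w\<^sup>2)) has_real_derivative (1 / (T + w\<^sup>2) * (2 * w))) (at w)"
      using DERIV_chain2[OF DERIV_ln_divide d0] Tw[of w] by simp
    have "(G has_real_derivative ((p * A - p * B) / N w - p / 2 * (2 * w / (T + w\<^sup>2)))) (at w)"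
      unfolding G_def using DERIV_diff[OF d1 DERIV_cmult[OF d2, of "p / 2"]] by simp
    also have "((p * A - p * B) / N w - p / 2 * (2 * w / (T + w\<^sup>2)))
      = p * ((A - B) * (T + w\<^sup>2) - w * N w) / (N w * (T + w\<^sup>2))"
      using N[of w] Tw[of w] w by (simp add: field_simps)
    also have "(A - B) * (T + w\<^sup>2) - w * N w = (A - B) * T - w * (A + B)"
      unfolding e by (simp add: algebra_simps power2_eq_square)
    also have "\<dots> = (A - B) * (T - tilt (p - 1) w)"
      using AB unfolding tilt_def A_def B_def by (simp add: field_simps)
    finally show ?thesis unfolding G'_def A_def B_def by (simp add: mult_ac)
  qed
  have sgn: "(1 - w) powr (p - 1) \<le> (1 + w) powr (p - 1)" if "0 < w" "w < 1" for w
    using powr_one_minus_less[of "p - 1" w] that p by auto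
  have "G u \<le> G v"
  proof (cases "u \<le> v")
    case True
    show ?thesis
    proof (rule DERIV_nonneg_imp_increasing_open[OF True _ cont])
      fix w assume w: "u < w" "w < v"
      have "tilt (p - 1) w \<le> T" unfolding T_def using w u v p by (intro tilt_mono) auto
      hence "G' w \<ge> 0" unfolding G'_def using N[of w] Tw[of w] w u v sgn[of w] p
        by (intro divide_nonneg_nonneg mult_nonneg_nonneg) auto
      thus "\<exists>y. (G has_real_derivative y) (at w) \<and> 0 \<le> y" using der[of w] w u v by auto
    qed (use u v in auto)
  next
    case False
    show ?thesis
    proof (rule DERIV_nonpos_imp_decreasing_open[of v u, OF _ _ cont])
      fix w assume w: "v < w" "w < u"
      have "T \<le> tilt (p - 1) w" unfolding T_def using w u v p by (intro tilt_mono) auto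
      hence "G' w \<le> 0" unfolding G'_def using N[of w] Tw[of w] w u v sgn[of w] p
        by (intro divide_nonpos_nonneg mult_nonneg_nonpos mult_nonneg_nonneg) auto
      thus "\<exists>y. (G has_real_derivative y) (at w) \<and> y \<le> 0" using der[of w] w u v by auto
    qed (use u v False in auto)
  qed
  hence "ln (N u) + p / 2 * ln (T + v\<^sup>2) \<le> ln (N v) + p / 2 * ln (T + u\<^sup>2)"
    unfolding G_def by simp
  hence "exp (ln (N u) + p / 2 * ln (T + v\<^sup>2)) \<le> exp (ln (N v) + p / 2 * ln (T + u\<^sup>2))"
    by simp
  thus ?thesis using N[of u] N[of v] Tw[of u] Tw[of v] u v T
    unfolding T_def[symmetric] by (simp add: exp_add powr_def N_def less_imp_neq[symmetric])
qed

definition two_point_bound :: "real \<Rightarrow> real \<Rightarrow> real \<Rightarrow> bool" where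
  "two_point_bound p t L \<longleftrightarrow>
     (\<forall>A B. (\<bar>A + t * B\<bar> powr p + \<bar>A - t * B\<bar> powr p) / 2 \<le> L * (A\<^sup>2 + B\<^sup>2) powr (p / 2))"

text \<open>The criticality condition is solved backwards: \<open>x\<close> is prescribed, the
  intermediate value theorem gives the critical point \<open>v\<close>, and \<open>t\<close> is the
  square root of \<open>tilt (p - 1) v\<close>. The best constant is then the value at the unit
  vector with coordinates \<open>sqrt (1 - x)\<close> and \<open>sqrt x\<close>.\<close>

lemma two_point_extremal:
  fixes p x :: real
  assumes p: "p \<ge> 2" and x: "0 < x" "x \<le> 1 / 2"
  obtains t L where "x \<le> t" "t \<le> 1"
    "L = (\<bar>sqrt (1 - x) + t * sqrt x\<bar> powr p + \<bar>sqrt (1 - x) - t * sqrt x\<bar> powr p) / 2"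
    "two_point_bound p t L"
proof -
  define q where "q = p - 1"
  define D where "D = (\<lambda>u. (1 + u) * (1 + u) powr q + (1 - u) * (1 - u) powr q)"
  \<comment> \<open>For \<open>0 < u\<close> this is u^2 / (tilt q u + u^2), the share of B^2 in A^2
    + B^2 when u = t B / A and t^2 = tilt q u. It runs from 0 at \<open>u = 0\<close> to 1/2 at
    \<open>u = 1\<close>, which is where the range of \<open>x\<close> comes from.\<close>
  define X where "X = (\<lambda>u. u * ((1 + u) powr q - (1 - u) powr q) / D u)"
  have D: "D u > 0" if "0 \<le> u" "u \<le> 1" for u
    unfolding D_def using that by (intro add_pos_nonneg) auto
  have "\<exists>u\<ge>0. u \<le> 1 \<and> X u = x"
  proof (rule IVT')
    have "D u \<noteq> 0" if "u \<in> {0..1}" for u using D[of u] that by auto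
    thus "continuous_on {0..1} X" unfolding X_def D_def q_def
      using p by (intro continuous_on_powr_const continuous_intros) auto
  qed (use x p in \<open>auto simp: X_def D_def q_def\<close>)
  then obtain v where v: "0 \<le> v" "v \<le> 1" "X v = x" by blast
  have v0: "v > 0" using v x by (cases "v = 0") (auto simp: X_def)
  define A B where "A = (1 + v) powr q" and "B = (1 - v) powr q"
  have AB: "B < A" "B \<ge> 0" unfolding A_def B_def
    using p v v0 by (auto simp: q_def intro!: powr_one_minus_less)
  define T where "T = tilt q v"
  have T: "0 < T" "T \<le> 1" unfolding T_def using p v v0
    by (auto simp: q_def intro!: tilt_pos tilt_le_1)
  have xe: "x = v * (A - B) / ((1 + v) * A + (1 - v) * B)"
    using v(3) by (simp add: X_def D_def A_def B_def)
  have dpos: "(1 + v) * A + (1 - v) * B > 0" using D[of v] v by (simp add: D_def A_def B_def)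
  have Te: "T = v * (A + B) / (A - B)" by (simp add: T_def tilt_def A_def B_def)
  have "T + v\<^sup>2 = v * ((1 + v) * A + (1 - v) * B) / (A - B)"
    unfolding Te using AB by (simp add: field_simps power2_eq_square)
  hence xT: "x * (T + v\<^sup>2) = v\<^sup>2" unfolding xe using AB dpos by (simp add: power2_eq_square)
  hence xT': "x * T = (1 - x) * v\<^sup>2" by (simp add: algebra_simps)
  have xv: "x \<le> v"
  proof -
    have "A - B \<le> (1 + v) * A + (1 - v) * B"
      using AB v by (smt (verit) mult_left_le_one_le mult_nonneg_nonneg mult_le_cancel_right1)
    thus ?thesis unfolding xe using dpos v0 by (simp add: divide_le_eq)
  qed
  define t where "t = sqrt T"
  have t: "0 < t" "t \<le> 1" "t\<^sup>2 = T" using T by (auto simp: t_def)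
  \<comment> \<open>Since \<open>x \<le> 1 / 2\<close>, the relation \<open>xT'\<close> forces
    \<open>v\<^sup>2 \<le> T\<close>, hence \<open>x \<le> v \<le> t\<close>. This lower bound on
    \<open>t\<close> later limits the cost of changing the degree.\<close>
  have "x * v\<^sup>2 \<le> (1 - x) * v\<^sup>2" using x by (intro mult_right_mono) auto
  hence "v\<^sup>2 \<le> T" using xT' x by (metis mult_le_cancel_left_pos)
  hence "v \<le> t" unfolding t_def using v by (simp add: real_le_rsqrt)
  hence xt: "x \<le> t" using xv by simp
  \<comment> \<open>The pair \<open>sqrt (1 - x)\<close>, \<open>sqrt x\<close> thus has critical
    coordinate \<open>t * sqrt x / sqrt (1 - x) = v\<close>.\<close>
  have tb: "t * sqrt x = sqrt (1 - x) * v"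
    using xT' v unfolding t_def by (metis mult.commute real_sqrt_mult real_sqrt_unique)
  define L where "L = (\<bar>sqrt (1 - x) + t * sqrt x\<bar> powr p + \<bar>sqrt (1 - x) - t * sqrt x\<bar> powr p) / 2"
  have "L = (\<bar>sqrt (1 - x) * (1 + v)\<bar> powr p + \<bar>sqrt (1 - x) * (1 - v)\<bar> powr p) / 2"
    unfolding L_def tb by (simp add: algebra_simps)
  also have "\<dots> = (1 - x) powr (p / 2) * ((1 + v) powr p + (1 - v) powr p) / 2"
  proof -
    have "sqrt (1 - x) powr p = (1 - x) powr (p / 2)"
      using x by (simp add: powr_half_sqrt[symmetric] powr_powr)
    thus ?thesis using x v by (simp add: abs_mult powr_mult) (simp add: distrib_left)
  qed
  finally have Le: "L = (1 - x) powr (p / 2) * ((1 + v) powr p + (1 - v) powr p) / 2" .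
  \<comment> \<open>For \<open>b \<le> a\<close> the coordinate \<open>u = t * b / a\<close> stays
    in the unit interval, where maximality of \<open>v\<close> applies; multiplying by
    \<open>a powr p\<close> undoes the normalization.\<close>
  have core: "((a + t * b) powr p + (a - t * b) powr p) / 2 \<le> L * (a\<^sup>2 + b\<^sup>2) powr (p / 2)"
    if ab: "0 \<le> b" "b \<le> a" "0 < a" for a b
  proof -
    define u where "u = t * b / a"
    have "t * b \<le> 1 * a" using t ab by (intro mult_mono) auto
    hence u: "0 \<le> u" "u \<le> 1" using ab t by (auto simp: u_def)
    have T1: "(1 - x) * (T + v\<^sup>2) = T" using xT by (simp add: algebra_simps)
    have "T + u\<^sup>2 = T * ((a\<^sup>2 + b\<^sup>2) / a\<^sup>2)"
      using ab unfolding u_def by (simp add: power_mult_distrib power_divide t(3) field_simps)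
    also have "\<dots> = (1 - x) * (T + v\<^sup>2) * ((a\<^sup>2 + b\<^sup>2) / a\<^sup>2)" unfolding T1 ..
    finally have ratio: "T + u\<^sup>2 = (1 - x) * (a\<^sup>2 + b\<^sup>2) / a\<^sup>2 * (T + v\<^sup>2)"
      by (simp add: mult_ac)
    have Tv: "T + v\<^sup>2 > 0" using T by (simp add: add_pos_nonneg)
    have "((1 + u) powr p + (1 - u) powr p) * (T + v\<^sup>2) powr (p / 2)
      \<le> ((1 + v) powr p + (1 - v) powr p) * (T + u\<^sup>2) powr (p / 2)"
      unfolding T_def q_def using two_point_critical_max[OF p u v0 v(2)] .
    also have "(T + u\<^sup>2) powr (p / 2) = ((1 - x) * (a\<^sup>2 + b\<^sup>2) / a\<^sup>2) powr (p / 2) * (T + v\<^sup>2) powr (p / 2)"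
      unfolding ratio by (rule powr_mult)
    finally have "(1 + u) powr p + (1 - u) powr p
      \<le> ((1 + v) powr p + (1 - v) powr p) * ((1 - x) * (a\<^sup>2 + b\<^sup>2) / a\<^sup>2) powr (p / 2)"
      using Tv by (simp add: mult.assoc[symmetric])
    also have "((1 - x) * (a\<^sup>2 + b\<^sup>2) / a\<^sup>2) powr (p / 2)
       = (1 - x) powr (p / 2) * (a\<^sup>2 + b\<^sup>2) powr (p / 2) / a powr p"
    proof -
      have "(a\<^sup>2) powr (p / 2) = a powr p"
        using ab by (simp add: powr_numeral[symmetric] powr_powr del: powr_numeral)
      thus ?thesis by (simp add: powr_mult powr_divide)
    qed
    finally have *: "(1 + u) powr p + (1 - u) powr p \<le> 2 * L * (a\<^sup>2 + b\<^sup>2) powr (p / 2) / a powr p"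
      unfolding Le by (simp add: mult_ac)
    have "a + t * b = a * (1 + u)" "a - t * b = a * (1 - u)"
      using ab by (simp_all add: u_def field_simps)
    hence "(a + t * b) powr p + (a - t * b) powr p = a powr p * ((1 + u) powr p + (1 - u) powr p)"
      by (simp only: powr_mult) (simp add: distrib_left)
    also have "\<dots> \<le> a powr p * (2 * L * (a\<^sup>2 + b\<^sup>2) powr (p / 2) / a powr p)"
      using * by (intro mult_left_mono) auto
    finally show ?thesis using ab by simp
  qed
  have "(\<bar>a + t * b\<bar> powr p + \<bar>a - t * b\<bar> powr p) / 2 \<le> L * (a\<^sup>2 + b\<^sup>2) powr (p / 2)"
    if ab: "0 \<le> a" "0 \<le> b" for a b
  proof (cases "b \<le> a")
    case True
    hence "t * b \<le> 1 * a" using t ab by (intro mult_mono) auto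
    thus ?thesis using core[of b a] ab True t by (cases "a = 0") auto
  next
    case False
    \<comment> \<open>Since \<open>t \<le> 1\<close>, swapping \<open>a\<close> and \<open>b\<close> only increases the left-hand side.\<close>
    have tab: "t * b \<le> b" "t * a \<le> a" "0 \<le> t * a" "0 \<le> t * b"
      using t ab by (simp_all add: mult_left_le_one_le)
    have "0 \<le> (1 - t) * (b - a)" using t False by (intro mult_nonneg_nonneg) auto
    hence 1: "a + t * b \<le> b + t * a" by (simp add: algebra_simps)
    have "0 \<le> (1 + t) * (b - a)" using t False by (intro mult_nonneg_nonneg) auto
    hence 2: "\<bar>a - t * b\<bar> \<le> b - t * a" using 1 tab False by (simp add: algebra_simps abs_le_iff)
    have "(\<bar>a + t * b\<bar> powr p + \<bar>a - t * b\<bar> powr p) / 2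
      \<le> ((b + t * a) powr p + (b - t * a) powr p) / 2"
      using 1 2 ab t tab p by (intro divide_right_mono add_mono powr_mono2) auto
    also have "\<dots> \<le> L * (b\<^sup>2 + a\<^sup>2) powr (p / 2)" using False ab by (intro core) auto
    finally show ?thesis by (simp add: add.commute)
  qed note nonneg = this
  \<comment> \<open>Changing the sign of \<open>A\<close> or \<open>B\<close> at most swaps the two
    terms on the left, so nonnegative arguments suffice.\<close>
  have "(\<bar>A + t * B\<bar> powr p + \<bar>A - t * B\<bar> powr p) / 2 \<le> L * (A\<^sup>2 + B\<^sup>2) powr (p / 2)" for A B
  proof -
    have "(\<bar>\<bar>A\<bar> + d\<bar> = \<bar>A + c\<bar> \<and> \<bar>\<bar>A\<bar> - d\<bar> = \<bar>A - c\<bar>) \<or>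
        (\<bar>\<bar>A\<bar> + d\<bar> = \<bar>A - c\<bar> \<and> \<bar>\<bar>A\<bar> - d\<bar> = \<bar>A + c\<bar>)" if "d = c \<or> d = - c" for c d
      using that by (auto simp: abs_if)
    moreover have "t * \<bar>B\<bar> = t * B \<or> t * \<bar>B\<bar> = - (t * B)" by (auto simp: abs_if)
    ultimately have "(\<bar>\<bar>A\<bar> + t * \<bar>B\<bar>\<bar> = \<bar>A + t * B\<bar> \<and> \<bar>\<bar>A\<bar> - t * \<bar>B\<bar>\<bar> = \<bar>A - t * B\<bar>) \<or>
        (\<bar>\<bar>A\<bar> + t * \<bar>B\<bar>\<bar> = \<bar>A - t * B\<bar> \<and> \<bar>\<bar>A\<bar> - t * \<bar>B\<bar>\<bar> = \<bar>A + t * B\<bar>)"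
      by blast
    thus ?thesis using nonneg[of "\<bar>A\<bar>" "\<bar>B\<bar>"] by auto
  qed
  thus ?thesis using that[OF xt t(2) L_def] unfolding two_point_bound_def by blast
qed

section \<open>Convexity of powers and Minkowski's inequality\<close>

lemma powr_convex_comb:
  fixes r a b l m :: real
  assumes "r \<ge> 1" "a \<ge> 0" "b \<ge> 0" "l \<ge> 0" "m \<ge> 0" "l + m = 1"
  shows "(l * a + m * b) powr r \<le> l * a powr r + m * b powr r"
proof -
  have le: "k powr r \<le> k" if "0 \<le> k" "k \<le> 1" for k :: real
    using powr_le_one_le[of k r] that assms(1) by (cases "k = 0") auto
  consider "a = 0" | "b = 0" | "a > 0" "b > 0" using assms by linarith
  thus ?thesis
  proof cases
    case 1 thus ?thesis using assms le[of m] by (simp add: powr_mult mult_right_mono)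
  next
    case 2 thus ?thesis using assms le[of l] by (simp add: powr_mult mult_right_mono)
  next
    case 3
    thus ?thesis using powr_convex[OF assms(1)] assms(4-6)
      unfolding convex_on_def by (auto simp: Ball_def)
  qed
qed

text \<open>Minkowski's inequality in \<open>\<ell>\<^sup>r\<close>, with the outer roots cleared.\<close>

lemma sum_powr_add_le:
  fixes F G :: "'a \<Rightarrow> real"
  assumes "finite I" "r \<ge> 1" "\<And>i. i \<in> I \<Longrightarrow> F i \<ge> 0" "\<And>i. i \<in> I \<Longrightarrow> G i \<ge> 0"
    and S: "S0 \<ge> 0" "S1 \<ge> 0"
    and F: "(\<Sum>i\<in>I. F i powr r) \<le> M * S0 powr r"
    and G: "(\<Sum>i\<in>I. G i powr r) \<le> M * S1 powr r"
  shows "(\<Sum>i\<in>I. (F i + G i) powr r) \<le> M * (S0 + S1) powr r"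
proof -
  \<comment> \<open>If \<open>S0\<close> or \<open>S1\<close> is 0, its family vanishes identically
    because \<open>0 powr r = 0\<close>; the normalization used in the remaining case would divide
    by zero here.\<close>
  have zero: "\<forall>i\<in>I. H i = 0" if "(\<Sum>i\<in>I. H i powr r) \<le> M * 0 powr r" for H :: "'a \<Rightarrow> real"
  proof -
    have "(\<Sum>i\<in>I. H i powr r) = 0" using that by (intro antisym sum_nonneg) auto
    thus ?thesis using assms(1) by (subst (asm) sum_nonneg_eq_0_iff) auto
  qed
  consider "S0 = 0" | "S1 = 0" | "S0 > 0" "S1 > 0" using S by linarith
  thus ?thesis
  proof cases
    case 1 thus ?thesis using zero[of F] F G by simp
  next
    case 2 thus ?thesis using zero[of G] F G by simp
  next
    case 3
    define S where "S = S0 + S1"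
    \<comment> \<open>With these weights, \<open>F i + G i\<close> is \<open>S\<close> times a
      convex combination of the normalized values \<open>F i / S0\<close> and
      \<open>G i / S1\<close>.\<close>
    define l m where "l = S0 / S" and "m = S1 / S"
    have lm: "l \<ge> 0" "m \<ge> 0" "l + m = 1" "S > 0"
      using 3 by (auto simp: l_def m_def S_def add_divide_distrib[symmetric])
    have "(F i + G i) powr r \<le> S powr r * (l * (F i powr r / S0 powr r) + m * (G i powr r / S1 powr r))"
      if "i \<in> I" for i
    proof -
      have "S * l = S0" "S * m = S1" using lm by (auto simp: l_def m_def)
      hence "F i + G i = S * (l * (F i / S0) + m * (G i / S1))"
        using 3 by (simp add: distrib_left mult.assoc[symmetric])
      hence "(F i + G i) powr r = S powr r * (l * (F i / S0) + m * (G i / S1)) powr r"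
        by (simp add: powr_mult)
      also have "\<dots> \<le> S powr r * (l * (F i / S0) powr r + m * (G i / S1) powr r)"
        using assms that 3 lm by (intro mult_left_mono powr_convex_comb) auto
      finally show ?thesis by (simp add: powr_divide)
    qed
    hence "(\<Sum>i\<in>I. (F i + G i) powr r)
      \<le> (\<Sum>i\<in>I. S powr r * (l * (F i powr r / S0 powr r) + m * (G i powr r / S1 powr r)))"
      by (rule sum_mono)
    also have "\<dots> = S powr r * (l * ((\<Sum>i\<in>I. F i powr r) / S0 powr r)
        + m * ((\<Sum>i\<in>I. G i powr r) / S1 powr r))"
      by (simp add: sum_distrib_left sum_divide_distrib sum.distrib distrib_left)
    also have "\<dots> \<le> S powr r * (l * M + m * M)"
      using F G 3 lm by (intro mult_left_mono add_mono) (auto simp: pos_divide_le_eq)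
    also have "\<dots> = M * S powr r" using lm by (simp add: distrib_right[symmetric])
    finally show ?thesis by (simp add: S_def)
  qed
qed

section \<open>Polynomials on the cube\<close>

lemma sum_cube_Suc:
  fixes g :: "(nat \<Rightarrow> nat) \<Rightarrow> real"
  shows "(\<Sum>y\<in>cube (Suc n). g y) = (\<Sum>y\<in>cube n. g (y(n := 0)) + g (y(n := 1)))"
proof -
  have "inj_on (\<lambda>(v, y). y(n := v)) ({0, 1 :: nat} \<times> cube n)"
    unfolding cube_def by (rule inj_combinator) auto
  hence "(\<Sum>y\<in>cube (Suc n). g y) = (\<Sum>(v, y)\<in>{0, 1} \<times> cube n. g (y(n := v)))"
    unfolding cube_def lessThan_Suc PiE_insert_eq
    by (subst sum.reindex) (auto simp: o_def case_prod_unfold)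
  thus ?thesis by (simp add: sum.cartesian_product[symmetric] sum.distrib)
qed

lemma weight_Suc_upd: "weight (Suc n) (\<alpha>(n := v)) = weight n \<alpha> + v"
proof -
  have "(\<Sum>i<n. (\<alpha>(n := v)) i) = (\<Sum>i<n. \<alpha> i)" by (intro sum.cong) auto
  thus ?thesis by (simp add: weight_def)
qed

lemma walsh_Suc_upd: "walsh (Suc n) (\<alpha>(n := v)) y = (-1) ^ (v * y n) * walsh n \<alpha> y"
proof -
  have "(\<Sum>i<n. (\<alpha>(n := v)) i * y i) = (\<Sum>i<n. \<alpha> i * y i)" by (intro sum.cong) auto
  thus ?thesis by (simp add: walsh_def power_add)
qed

lemma walsh_upd: "walsh n \<alpha> (y(n := v)) = walsh n \<alpha> y"
proof -
  have "(\<Sum>i<n. \<alpha> i * (y(n := v)) i) = (\<Sum>i<n. \<alpha> i * y i)" by (intro sum.cong) auto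
  thus ?thesis by (simp add: walsh_def)
qed

lemma walsh_square: "(walsh n \<alpha> y)\<^sup>2 = 1"
  by (simp add: walsh_def power_mult[symmetric] mult.commute[of _ 2] power_mult)

lemma weight_le: "\<alpha> \<in> cube n \<Longrightarrow> weight n \<alpha> \<le> n"
proof -
  assume "\<alpha> \<in> cube n"
  hence "(\<Sum>i<n. \<alpha> i) \<le> (\<Sum>i<n. 1)"
    by (intro sum_mono) (force simp: cube_def PiE_def Pi_def)
  thus ?thesis by (simp add: weight_def)
qed

definition walsh_poly :: "nat \<Rightarrow> ((nat \<Rightarrow> nat) \<Rightarrow> real) \<Rightarrow> (nat \<Rightarrow> nat) \<Rightarrow> real" where
  "walsh_poly n c y = (\<Sum>\<alpha>\<in>cube n. c \<alpha> * walsh n \<alpha> y)"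

text \<open>Splitting off the last coordinate drives the inductions on the dimension.\<close>

lemma walsh_poly_Suc:
  "walsh_poly (Suc n) c y =
     walsh_poly n (\<lambda>\<alpha>. c (\<alpha>(n := 0))) y + (-1) ^ y n * walsh_poly n (\<lambda>\<alpha>. c (\<alpha>(n := 1))) y"
  unfolding walsh_poly_def
  by (simp add: sum_cube_Suc walsh_Suc_upd sum.distrib sum_distrib_left mult_ac)

lemma walsh_poly_upd: "walsh_poly n c (y(n := v)) = walsh_poly n c y"
  by (simp add: walsh_poly_def walsh_upd)

lemma walsh_poly_scale: "walsh_poly n (\<lambda>\<alpha>. k * c \<alpha>) y = k * walsh_poly n c y"
  by (simp add: walsh_poly_def sum_distrib_left mult_ac)

text \<open>Induction on the dimension; the two values of the last coordinate combine by the
  parallelogram identity.\<close>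

lemma walsh_poly_parseval:
  "(\<Sum>y\<in>cube n. (walsh_poly n c y)\<^sup>2) = 2 ^ n * (\<Sum>\<alpha>\<in>cube n. (c \<alpha>)\<^sup>2)"
proof (induction n arbitrary: c)
  case 0
  show ?case by (simp add: walsh_poly_def cube_def walsh_def)
next
  case (Suc n)
  define g where "g = (\<lambda>v. walsh_poly n (\<lambda>\<alpha>. c (\<alpha>(n := v))))"
  have "(\<Sum>y\<in>cube (Suc n). (walsh_poly (Suc n) c y)\<^sup>2)
    = (\<Sum>y\<in>cube n. (g 0 y + g 1 y)\<^sup>2 + (g 0 y - g 1 y)\<^sup>2)"
    by (simp add: sum_cube_Suc walsh_poly_Suc walsh_poly_upd g_def)
  also have "\<dots> = (\<Sum>y\<in>cube n. 2 * (g 0 y)\<^sup>2 + 2 * (g 1 y)\<^sup>2)"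
    by (intro sum.cong) (auto simp: power2_eq_square algebra_simps)
  also have "\<dots> = 2 * (2 ^ n * (\<Sum>\<alpha>\<in>cube n. (c (\<alpha>(n := 0)))\<^sup>2))
      + 2 * (2 ^ n * (\<Sum>\<alpha>\<in>cube n. (c (\<alpha>(n := 1)))\<^sup>2))"
    by (simp add: sum.distrib sum_distrib_left[symmetric] g_def Suc.IH)
  also have "\<dots> = 2 ^ Suc n * (\<Sum>\<alpha>\<in>cube (Suc n). (c \<alpha>)\<^sup>2)"
    by (simp add: sum_cube_Suc sum.distrib algebra_simps)
  finally show ?case .
qed

lemma square_powr_half: "(z\<^sup>2) powr (p / 2) = \<bar>z\<bar> powr p" for z p :: real
proof -
  have "(z\<^sup>2) powr (p / 2) = (\<bar>z\<bar> powr 2) powr (p / 2)" by simp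
  thus ?thesis by (simp only: powr_powr) simp
qed

text \<open>Induction on the dimension. The two-point inequality handles the last coordinate
  pointwise and leaves the sum of \<open>(g 0 y)\<^sup>2 + (g 1 y)\<^sup>2\<close> to the power
  \<open>p / 2\<close>. Since \<open>p / 2 \<ge> 1\<close>, Minkowski's inequality merges the
  induction hypotheses for \<open>g 0\<close> and \<open>g 1\<close>.\<close>

lemma two_point_bound_tensor:
  assumes p: "p \<ge> 2" and L: "L \<ge> 0" and tp: "two_point_bound p t L"
  shows "(\<Sum>y\<in>cube n. \<bar>walsh_poly n (\<lambda>\<alpha>. t ^ weight n \<alpha> * c \<alpha>) y\<bar> powr p)
    \<le> (2 * L) ^ n * (\<Sum>\<alpha>\<in>cube n. (c \<alpha>)\<^sup>2) powr (p / 2)"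
proof (induction n arbitrary: c)
  case 0
  show ?case by (simp add: walsh_poly_def cube_def walsh_def weight_def square_powr_half)
next
  case (Suc n)
  \<comment> \<open>\<open>g v\<close> already carries the noise of the first \<open>n\<close>
    coordinates; the last coordinate contributes one further factor \<open>t\<close>, and only to
    \<open>g 1\<close>.\<close>
  define g where "g = (\<lambda>v. walsh_poly n (\<lambda>\<alpha>. t ^ weight n \<alpha> * c (\<alpha>(n := v))))"
  have gu: "g v (y(n := w)) = g v y" for v w y by (simp add: g_def walsh_poly_upd)
  have g0: "walsh_poly n (\<lambda>\<alpha>. t ^ weight n \<alpha> * c (\<alpha>(n := 0))) y = g 0 y" for y
    by (simp add: g_def)
  have g1: "walsh_poly n (\<lambda>\<alpha>. t * t ^ weight n \<alpha> * c (\<alpha>(n := Suc 0))) y = t * g (Suc 0) y" for y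
    by (simp add: g_def walsh_poly_scale[symmetric] mult.assoc)
  have "(\<Sum>y\<in>cube (Suc n). \<bar>walsh_poly (Suc n) (\<lambda>\<alpha>. t ^ weight (Suc n) \<alpha> * c \<alpha>) y\<bar> powr p)
    = (\<Sum>y\<in>cube n. \<bar>g 0 y + t * g 1 y\<bar> powr p + \<bar>g 0 y - t * g 1 y\<bar> powr p)"
    by (simp add: sum_cube_Suc walsh_poly_Suc walsh_poly_upd weight_Suc_upd g0 g1 gu)
  also have "\<dots> \<le> (\<Sum>y\<in>cube n. 2 * L * ((g 0 y)\<^sup>2 + (g 1 y)\<^sup>2) powr (p / 2))"
  proof (rule sum_mono)
    fix y
    show "\<bar>g 0 y + t * g 1 y\<bar> powr p + \<bar>g 0 y - t * g 1 y\<bar> powr p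
      \<le> 2 * L * ((g 0 y)\<^sup>2 + (g 1 y)\<^sup>2) powr (p / 2)"
      using tp[unfolded two_point_bound_def, rule_format, of "g 0 y" "g 1 y"] by simp
  qed
  also have "\<dots> = 2 * L * (\<Sum>y\<in>cube n. ((g 0 y)\<^sup>2 + (g 1 y)\<^sup>2) powr (p / 2))"
    by (simp add: sum_distrib_left)
  also have "\<dots> \<le> 2 * L * ((2 * L) ^ n *
      ((\<Sum>\<alpha>\<in>cube n. (c (\<alpha>(n := 0)))\<^sup>2) + (\<Sum>\<alpha>\<in>cube n. (c (\<alpha>(n := 1)))\<^sup>2)) powr (p / 2))"
    using p L Suc.IH[of "\<lambda>\<alpha>. c (\<alpha>(n := 0))"] Suc.IH[of "\<lambda>\<alpha>. c (\<alpha>(n := 1))"]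
    by (intro mult_left_mono sum_powr_add_le)
      (auto simp: finite_cube g_def square_powr_half intro!: sum_nonneg)
  also have "\<dots> = (2 * L) ^ Suc n * (\<Sum>\<alpha>\<in>cube (Suc n). (c \<alpha>)\<^sup>2) powr (p / 2)"
    by (simp add: sum_cube_Suc sum.distrib)
  finally show ?case .
qed

section \<open>Moments of homogeneous polynomials\<close>

definition moment :: "nat \<Rightarrow> real \<Rightarrow> ((nat \<Rightarrow> nat) \<Rightarrow> real) \<Rightarrow> real" where
  "moment n p f = (\<Sum>y\<in>cube n. \<bar>f y\<bar> powr p) / 2 ^ n"

lemma moment_nonneg: "moment n p f \<ge> 0"
  by (simp add: moment_def sum_nonneg)

lemma moment_cong: "(\<And>y. y \<in> cube n \<Longrightarrow> f y = g y) \<Longrightarrow> moment n p f = moment n p g"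
  by (simp add: moment_def)

lemma moment_ratio_eq:
  assumes "p > 0"
  shows "moment_ratio n p f = moment n p f / moment n 2 f powr (p / 2)"
proof -
  have "(\<Sum>y\<in>cube n. \<bar>f y\<bar> powr p) \<ge> 0" by (simp add: sum_nonneg)
  thus ?thesis using assms unfolding moment_ratio_def cube_norm_eq_sum moment_def
    by (simp add: powr_powr)
qed

lemma moment_2_walsh_poly: "moment n 2 (walsh_poly n c) = (\<Sum>\<alpha>\<in>cube n. (c \<alpha>)\<^sup>2)"
  unfolding moment_def using walsh_poly_parseval[of n c] by simp

lemma homogeneous_poly_walsh_poly:
  assumes "homogeneous_poly n s f"
  obtains c where "\<And>\<alpha>. weight n \<alpha> \<noteq> s \<Longrightarrow> c \<alpha> = 0" "\<And>y. y \<in> cube n \<Longrightarrow> f y = walsh_poly n c y"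
proof -
  obtain c where c: "\<forall>y\<in>cube n. f y = (\<Sum>\<alpha> | \<alpha> \<in> cube n \<and> weight n \<alpha> = s. c \<alpha> * walsh n \<alpha> y)"
    using assms unfolding homogeneous_poly_def by blast
  define d where "d = (\<lambda>\<alpha>. if weight n \<alpha> = s then c \<alpha> else 0)"
  have "(\<Sum>\<alpha> | \<alpha> \<in> cube n \<and> weight n \<alpha> = s. c \<alpha> * walsh n \<alpha> y) = walsh_poly n d y" for y
    unfolding walsh_poly_def by (intro sum.mono_neutral_cong_left) (auto simp: d_def finite_cube)
  thus ?thesis using c by (intro that[of d]) (auto simp: d_def)
qed

text \<open>On degree \<open>s\<close> the noise operator is multiplication by the scalar
  \<open>t ^ s\<close>, so the tensorized inequality bounds the moment itself.\<close>

lemma moment_homogeneous_le: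
  assumes p: "p \<ge> 2" and L: "L \<ge> 0" and t: "t \<ge> 0" and tp: "two_point_bound p t L"
    and f: "homogeneous_poly n s f"
  shows "(t ^ s) powr p * moment n p f \<le> L ^ n * moment n 2 f powr (p / 2)"
proof -
  obtain c where c: "\<And>\<alpha>. weight n \<alpha> \<noteq> s \<Longrightarrow> c \<alpha> = 0" "\<And>y. y \<in> cube n \<Longrightarrow> f y = walsh_poly n c y"
    using homogeneous_poly_walsh_poly[OF f] by metis
  have "(\<lambda>\<alpha>. t ^ weight n \<alpha> * c \<alpha>) = (\<lambda>\<alpha>. t ^ s * c \<alpha>)" using c(1) by force
  hence "walsh_poly n (\<lambda>\<alpha>. t ^ weight n \<alpha> * c \<alpha>) y = t ^ s * walsh_poly n c y" for y
    by (simp add: walsh_poly_scale)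
  hence "(t ^ s) powr p * (\<Sum>y\<in>cube n. \<bar>walsh_poly n c y\<bar> powr p)
    \<le> (2 * L) ^ n * (\<Sum>\<alpha>\<in>cube n. (c \<alpha>)\<^sup>2) powr (p / 2)"
    using two_point_bound_tensor[OF p L tp, of n c] t
    by (simp add: abs_mult powr_mult sum_distrib_left)
  also have "(\<Sum>\<alpha>\<in>cube n. (c \<alpha>)\<^sup>2) = moment n 2 f"
    using c(2) by (simp add: moment_2_walsh_poly[symmetric] cong: moment_cong)
  finally have "(t ^ s) powr p * (\<Sum>y\<in>cube n. \<bar>f y\<bar> powr p) \<le> (2 * L) ^ n * moment n 2 f powr (p / 2)"
    using c(2) by simp
  thus ?thesis unfolding moment_def[of n p f] by (simp add: field_simps)
qed

text \<open>Counting a level of the cube as a sum of indicators turns the induction into Pascal's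
  rule.\<close>

lemma sum_weight_indicator:
  "(\<Sum>\<alpha>\<in>cube n. if weight n \<alpha> = k then 1 else 0 :: real) = real (n choose k)"
proof (induction n arbitrary: k)
  case 0
  show ?case by (auto simp: cube_def weight_def)
next
  case (Suc n)
  show ?case
    by (cases k) (simp_all add: sum_cube_Suc weight_Suc_upd sum.distrib Suc.IH)
qed

text \<open>Cauchy-Schwarz: only \<open>n choose s\<close> characters occur, and each has square 1
  at every point.\<close>

lemma homogeneous_poly_square_le:
  assumes "homogeneous_poly n s f" "y \<in> cube n"
  shows "(f y)\<^sup>2 \<le> real (n choose s) * moment n 2 f"
proof -
  obtain c where c: "\<And>\<alpha>. weight n \<alpha> \<noteq> s \<Longrightarrow> c \<alpha> = 0" "\<And>y. y \<in> cube n \<Longrightarrow> f y = walsh_poly n c y"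
    using homogeneous_poly_walsh_poly[OF assms(1)] by metis
  have "f y = (\<Sum>\<alpha>\<in>cube n. ((if weight n \<alpha> = s then 1 else 0) * walsh n \<alpha> y) * c \<alpha>)"
    using c assms(2) unfolding walsh_poly_def by (auto intro!: sum.cong)
  hence "(f y)\<^sup>2 \<le> (\<Sum>\<alpha>\<in>cube n. ((if weight n \<alpha> = s then 1 else 0) * walsh n \<alpha> y)\<^sup>2) *
     (\<Sum>\<alpha>\<in>cube n. (c \<alpha>)\<^sup>2)"
    by (simp only: Cauchy_Schwarz_ineq_sum)
  also have "(\<Sum>\<alpha>\<in>cube n. ((if weight n \<alpha> = s then 1 else 0) * walsh n \<alpha> y)\<^sup>2) = real (n choose s)"
    unfolding sum_weight_indicator[symmetric]
    by (intro sum.cong) (auto simp: walsh_square)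
  also have "(\<Sum>\<alpha>\<in>cube n. (c \<alpha>)\<^sup>2) = moment n 2 f"
    using c(2) by (simp add: moment_2_walsh_poly[symmetric] cong: moment_cong)
  finally show ?thesis .
qed

lemma moment_homogeneous_le_binomial:
  assumes "p \<ge> 2" "homogeneous_poly n s f"
  shows "moment n p f \<le> real (n choose s) powr (p / 2) * moment n 2 f powr (p / 2)"
proof -
  have "\<bar>f y\<bar> powr p \<le> real (n choose s) powr (p / 2) * moment n 2 f powr (p / 2)" if "y \<in> cube n" for y
  proof -
    have "\<bar>f y\<bar> powr p = ((f y)\<^sup>2) powr (p / 2)" by (simp add: square_powr_half)
    also have "\<dots> \<le> (real (n choose s) * moment n 2 f) powr (p / 2)"
      using assms that by (intro powr_mono2 homogeneous_poly_square_le) auto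
    finally show ?thesis by (simp add: powr_mult)
  qed
  hence "(\<Sum>y\<in>cube n. \<bar>f y\<bar> powr p)
    \<le> real (card (cube n)) * (real (n choose s) powr (p / 2) * moment n 2 f powr (p / 2))"
    by (intro sum_bounded_above) auto
  thus ?thesis unfolding moment_def[of n p f] by (simp add: card_cube field_simps)
qed

text \<open>Jensen's inequality for the uniform measure, applied to the square of
  \<open>f\<close>.\<close>

lemma moment_2_le_moment:
  assumes "p \<ge> 2"
  shows "moment n 2 f powr (p / 2) \<le> moment n p f"
proof -
  have conv: "convex_on {0..} (\<lambda>x::real. x powr (p / 2))"
    using assms by (intro convex_onI) (auto intro!: powr_convex_comb simp: convex_real_interval)
  have "(\<Sum>y\<in>cube n. (1 / 2 ^ n) *\<^sub>R (f y)\<^sup>2) powr (p / 2)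
    \<le> (\<Sum>y\<in>cube n. (1 / 2 ^ n) * ((f y)\<^sup>2) powr (p / 2))"
    by (rule convex_on_sum[OF finite_cube cube_nonempty conv]) (auto simp: card_cube)
  thus ?thesis by (simp add: square_powr_half moment_def sum_divide_distrib)
qed

section \<open>Krawchouk polynomials: changing dimension and degree, and the generating
  product\<close>

lemma krawchouk_eq_walsh_poly:
  "krawchouk n s = walsh_poly n (\<lambda>\<alpha>. if weight n \<alpha> = s then 1 else 0)"
  unfolding krawchouk_def[abs_def] walsh_poly_def
  by (intro ext sum.mono_neutral_cong_left) (auto simp: finite_cube)

lemma homogeneous_poly_krawchouk: "homogeneous_poly n s (krawchouk n s)"
  unfolding homogeneous_poly_def krawchouk_def by (intro exI[of _ "\<lambda>_. 1"]) simp

lemma moment_2_krawchouk: "moment n 2 (krawchouk n s) = real (n choose s)"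
  unfolding krawchouk_eq_walsh_poly moment_2_walsh_poly sum_weight_indicator[symmetric]
  by (intro sum.cong) auto

lemma krawchouk_Suc_0: "krawchouk (Suc n) 0 y = krawchouk n 0 y"
  by (simp add: krawchouk_eq_walsh_poly walsh_poly_Suc weight_Suc_upd) (simp add: walsh_poly_def)

lemma krawchouk_Suc_Suc:
  "krawchouk (Suc n) (Suc k) y = krawchouk n (Suc k) y + (-1) ^ y n * krawchouk n k y"
  by (simp add: krawchouk_eq_walsh_poly walsh_poly_Suc weight_Suc_upd)

lemma krawchouk_upd: "krawchouk n k (y(n := v)) = krawchouk n k y"
  by (simp add: krawchouk_eq_walsh_poly walsh_poly_upd)

text \<open>Convexity, as \<open>a\<close> is the midpoint of \<open>a + b\<close> and
  \<open>a - b\<close>.\<close>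

lemma abs_powr_le_mean:
  fixes a b p :: real
  assumes "p \<ge> 1"
  shows "2 * \<bar>a\<bar> powr p \<le> \<bar>a + b\<bar> powr p + \<bar>a - b\<bar> powr p"
proof -
  have "\<bar>a\<bar> \<le> 1 / 2 * \<bar>a + b\<bar> + 1 / 2 * \<bar>a - b\<bar>"
    unfolding abs_if by (auto simp: field_simps)
  hence "\<bar>a\<bar> powr p \<le> (1 / 2 * \<bar>a + b\<bar> + 1 / 2 * \<bar>a - b\<bar>) powr p"
    using assms by (intro powr_mono2) auto
  also have "\<dots> \<le> 1 / 2 * \<bar>a + b\<bar> powr p + 1 / 2 * \<bar>a - b\<bar> powr p"
    using assms by (intro powr_convex_comb) auto
  finally show ?thesis by simp
qed

lemma moment_krawchouk_Suc_Suc: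
  "moment (Suc n) p (krawchouk (Suc n) (Suc k)) =
    (\<Sum>y\<in>cube n. \<bar>krawchouk n (Suc k) y + krawchouk n k y\<bar> powr p
      + \<bar>krawchouk n (Suc k) y - krawchouk n k y\<bar> powr p) / 2 / 2 ^ n"
  by (simp add: moment_def sum_cube_Suc krawchouk_Suc_Suc krawchouk_upd)

text \<open>
  Averaging over the last coordinate, possibly after multiplying by its character, maps
  \<open>krawchouk (Suc n) (Suc k)\<close> to \<open>krawchouk n (Suc k)\<close> or to \<open>krawchouk n k\<close>, and is a contraction.
\<close>

lemma moment_krawchouk_mono_degree:
  assumes "p \<ge> 1"
  shows "moment n p (krawchouk n k) \<le> moment (Suc n) p (krawchouk (Suc n) (Suc k))"
proof -
  have "2 * (\<Sum>y\<in>cube n. \<bar>krawchouk n k y\<bar> powr p) \<le>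
    (\<Sum>y\<in>cube n. \<bar>krawchouk n (Suc k) y + krawchouk n k y\<bar> powr p
      + \<bar>krawchouk n (Suc k) y - krawchouk n k y\<bar> powr p)"
    unfolding sum_distrib_left
    using abs_powr_le_mean[OF assms] by (intro sum_mono) (simp add: add.commute abs_minus_commute)
  thus ?thesis unfolding moment_krawchouk_Suc_Suc by (simp add: moment_def field_simps)
qed

lemma moment_krawchouk_mono_dim:
  assumes "p \<ge> 1"
  shows "moment n p (krawchouk n k) \<le> moment (Suc n) p (krawchouk (Suc n) k)"
proof (cases k)
  case 0
  thus ?thesis by (simp add: moment_def sum_cube_Suc krawchouk_Suc_0 krawchouk_upd
        sum_distrib_left[symmetric])
next
  case (Suc j)
  have "2 * (\<Sum>y\<in>cube n. \<bar>krawchouk n (Suc j) y\<bar> powr p) \<le>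
    (\<Sum>y\<in>cube n. \<bar>krawchouk n (Suc j) y + krawchouk n j y\<bar> powr p
      + \<bar>krawchouk n (Suc j) y - krawchouk n j y\<bar> powr p)"
    unfolding sum_distrib_left using abs_powr_le_mean[OF assms] by (intro sum_mono)
  thus ?thesis unfolding Suc moment_krawchouk_Suc_Suc by (simp add: moment_def field_simps)
qed

text \<open>Of the \<open>d\<close> added coordinates, \<open>j\<close> raise the degree together
  with the dimension and the others raise only the dimension.\<close>

lemma moment_krawchouk_mono:
  assumes "p \<ge> 1" "j \<le> d"
  shows "moment n p (krawchouk n k) \<le> moment (n + d) p (krawchouk (n + d) (k + j))"
  using assms(2)
proof (induction d arbitrary: j)
  case (Suc d)
  show ?case
  proof (cases j)
    case 0
    thus ?thesis using Suc.IH[of 0] moment_krawchouk_mono_dim[OF assms(1), of "n + d" k] by simp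
  next
    case (Suc i)
    thus ?thesis using Suc.IH[of i] Suc.prems
        moment_krawchouk_mono_degree[OF assms(1), of "n + d" "k + i"] by simp
  qed
qed simp

text \<open>By the absorption identities, each new element multiplies the binomial coefficient by at
  most the new dimension, whether or not the lower index moves too. The condition
  \<open>k \<le> m\<close> keeps the factor \<open>Suc (m + d) - k\<close> at least 1.\<close>

lemma binomial_shift_le:
  assumes "j \<le> d" "k \<le> m"
  shows "real ((m + d) choose (k + j)) \<le> real (m + d) ^ d * real (m choose k)"
  using assms(1)
proof (induction d arbitrary: j)
  case (Suc d)
  have step: "real ((m + d) choose i) * real (m + Suc d) \<le> real (m + Suc d) ^ Suc d * real (m choose k)"
    if "real ((m + d) choose i) \<le> real (m + d) ^ d * real (m choose k)" for i
  proof -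
    have "real ((m + d) choose i) \<le> real (m + Suc d) ^ d * real (m choose k)"
      by (rule order_trans[OF that]) (intro mult_right_mono power_mono, auto)
    hence "real ((m + d) choose i) * real (m + Suc d)
      \<le> real (m + Suc d) ^ d * real (m choose k) * real (m + Suc d)" by (intro mult_right_mono) auto
    thus ?thesis by (simp add: mult_ac)
  qed
  show ?case
  proof (cases j)
    case 0
    have "(Suc (m + d) - k) * (Suc (m + d) choose k) = Suc (m + d) * ((m + d) choose k)"
      using binomial_absorb_comp[of "Suc (m + d)" k] by simp
    moreover have "1 * (Suc (m + d) choose k) \<le> (Suc (m + d) - k) * (Suc (m + d) choose k)"
      using assms(2) by (intro mult_right_mono) auto
    ultimately have "(Suc (m + d) choose k) \<le> ((m + d) choose k) * Suc (m + d)"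
      by (simp add: mult.commute)
    hence "real (Suc (m + d) choose k) \<le> real ((m + d) choose k) * real (m + Suc d)"
      by (metis of_nat_le_iff of_nat_mult add_Suc_right)
    from order_trans[OF this step] Suc.IH[of 0] 0 show ?thesis
      by (simp del: of_nat_add of_nat_Suc power_Suc)
  next
    case (Suc i)
    have "Suc (k + i) * (Suc (m + d) choose Suc (k + i)) = Suc (m + d) * ((m + d) choose (k + i))"
      by (rule Suc_times_binomial)
    moreover have "1 * (Suc (m + d) choose Suc (k + i)) \<le> Suc (k + i) * (Suc (m + d) choose Suc (k + i))"
      by (intro mult_right_mono) auto
    ultimately have "(Suc (m + d) choose Suc (k + i)) \<le> ((m + d) choose (k + i)) * Suc (m + d)"
      by (simp add: mult.commute)
    hence "real (Suc (m + d) choose Suc (k + i)) \<le> real ((m + d) choose (k + i)) * real (m + Suc d)"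
      by (metis of_nat_le_iff of_nat_mult add_Suc_right)
    from order_trans[OF this step] Suc.IH[of i] Suc Suc.prems show ?thesis
      by (simp del: of_nat_add of_nat_Suc power_Suc)
  qed
qed simp

text \<open>Expanding the product gives a Walsh polynomial whose coefficients depend only on the
  weight; grouping by weight produces the Krawchouk polynomials.\<close>

lemma prod_eq_sum_krawchouk:
  fixes a b :: real
  shows "(\<Prod>i<n. a + b * (-1) ^ y i) = (\<Sum>k\<le>n. a ^ (n - k) * b ^ k * krawchouk n k y)"
proof -
  have "walsh_poly n (\<lambda>\<alpha>. a ^ (n - weight n \<alpha>) * b ^ weight n \<alpha>) y = (\<Prod>i<n. a + b * (-1) ^ y i)"
  proof (induction n)
    case 0
    show ?case by (simp add: walsh_poly_def cube_def walsh_def weight_def)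
  next
    case (Suc n)
    have 1: "walsh_poly n (\<lambda>\<alpha>. a ^ (Suc n - weight n \<alpha>) * b ^ weight n \<alpha>) y
      = a * walsh_poly n (\<lambda>\<alpha>. a ^ (n - weight n \<alpha>) * b ^ weight n \<alpha>) y"
      unfolding walsh_poly_scale[symmetric] unfolding walsh_poly_def
      using weight_le by (intro sum.cong) (auto simp: Suc_diff_le)
    have 2: "walsh_poly n (\<lambda>\<alpha>. a ^ (n - weight n \<alpha>) * (b * b ^ weight n \<alpha>)) y
      = b * walsh_poly n (\<lambda>\<alpha>. a ^ (n - weight n \<alpha>) * b ^ weight n \<alpha>) y"
      unfolding walsh_poly_scale[symmetric] by (simp add: mult_ac)
    show ?case using Suc.IH
      by (simp add: walsh_poly_Suc weight_Suc_upd 1 2) (simp add: algebra_simps)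
  qed
  also have "walsh_poly n (\<lambda>\<alpha>. a ^ (n - weight n \<alpha>) * b ^ weight n \<alpha>) y
    = (\<Sum>k\<le>n. \<Sum>\<alpha> | \<alpha> \<in> cube n \<and> weight n \<alpha> = k. a ^ (n - weight n \<alpha>) * b ^ weight n \<alpha> * walsh n \<alpha> y)"
    unfolding walsh_poly_def using weight_le
    by (intro sum.group[symmetric]) (auto simp: finite_cube)
  also have "\<dots> = (\<Sum>k\<le>n. a ^ (n - k) * b ^ k * krawchouk n k y)"
    unfolding krawchouk_def sum_distrib_left by (intro sum.cong) auto
  finally show ?thesis by simp
qed

text \<open>The coordinates are independent, so the moment of the product factorizes; this makes the
  lower bound \<open>L ^ n\<close> exact.\<close>

lemma sum_cube_prod_powr:
  fixes a b p :: real
  shows "(\<Sum>y\<in>cube n. \<bar>\<Prod>i<n. a + b * (-1) ^ y i\<bar> powr p) = (\<bar>a + b\<bar> powr p + \<bar>a - b\<bar> powr p) ^ n"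
proof -
  have "(\<bar>a + b\<bar> powr p + \<bar>a - b\<bar> powr p) ^ n
    = (\<Prod>i<n. \<Sum>v\<in>{0, 1::nat}. \<bar>a + b * (-1) ^ v\<bar> powr p)" by simp
  also have "\<dots> = (\<Sum>y\<in>cube n. \<Prod>i<n. \<bar>a + b * (-1) ^ y i\<bar> powr p)"
    unfolding cube_def by (intro prod_sum_PiE) auto
  finally show ?thesis by (simp add: abs_prod prod_powr_distrib)
qed

text \<open>The sum is compared with its largest term; the loss is only polynomial in
  \<open>n\<close> when \<open>p\<close> is fixed.\<close>

lemma abs_sum_powr_le:
  fixes z :: "nat \<Rightarrow> real"
  assumes "p \<ge> 0"
  shows "\<bar>\<Sum>k\<le>n. z k\<bar> powr p \<le> real (n + 1) powr p * (\<Sum>k\<le>n. \<bar>z k\<bar> powr p)"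
proof -
  define M where "M = Max ((\<lambda>k. \<bar>z k\<bar>) ` {..n})"
  have "M \<in> (\<lambda>k. \<bar>z k\<bar>) ` {..n}" unfolding M_def by (intro Max_in) auto
  then obtain j where j: "j \<le> n" "M = \<bar>z j\<bar>" by auto
  have M: "\<bar>z k\<bar> \<le> M" if "k \<le> n" for k unfolding M_def using that by (intro Max_ge) auto
  have "\<bar>\<Sum>k\<le>n. z k\<bar> \<le> (\<Sum>k\<le>n. \<bar>z k\<bar>)" by (rule sum_abs)
  also have "\<dots> \<le> real (card {..n}) * M" using M by (intro sum_bounded_above) auto
  finally have "\<bar>\<Sum>k\<le>n. z k\<bar> powr p \<le> (real (n + 1) * M) powr p"
    using assms by (intro powr_mono2) auto
  also have "\<dots> = real (n + 1) powr p * \<bar>z j\<bar> powr p" by (simp add: powr_mult j)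
  also have "\<dots> \<le> real (n + 1) powr p * (\<Sum>k\<le>n. \<bar>z k\<bar> powr p)"
    using j by (intro mult_left_mono member_le_sum) auto
  finally show ?thesis .
qed

section \<open>Comparison with Krawchouk polynomials\<close>

lemma krawchouk_moment_near_mean:
  fixes p x t L W :: real
  assumes p: "p \<ge> 2" and x: "0 < x" "x \<le> 1 / 2" and t: "t > 0"
    and tp: "two_point_bound p t L"
    and L: "L = (\<bar>sqrt (1 - x) + t * sqrt x\<bar> powr p + \<bar>sqrt (1 - x) - t * sqrt x\<bar> powr p) / 2"
    and n: "n > 0" and W: "W > 0"
    and tail: "real (n + 1) powr p * (2 * exp (-2 * W\<^sup>2 / n)) \<le> 1 / 2"
  obtains k where "k \<le> n" "\<bar>real k - n * x\<bar> < W"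
    "L ^ n * real (n choose k) powr (p / 2)
      \<le> 4 * real (n + 1) powr (p + 1) * (t ^ k) powr p * moment n p (krawchouk n k)"
proof -
  define a b where "a = sqrt (1 - x)" and "b = sqrt x"
  have ab: "a > 0" "b > 0" using x by (auto simp: a_def b_def)
  have L0: "L > 0" unfolding L a_def[symmetric] b_def[symmetric]
  proof (intro divide_pos_pos add_pos_nonneg)
    have "a + t * b > 0" using ab t by (simp add: add_pos_pos)
    thus "\<bar>a + t * b\<bar> powr p > 0" by simp
  qed auto
  define K where "K = (\<lambda>k. moment n p (krawchouk n k))"
  \<comment> \<open>\<open>P\<close> is the binomial distribution with mean \<open>n * x\<close>,
    and \<open>Q k\<close> is the \<open>p\<close>-th moment of the degree \<open>k\<close> part of
    the product of the factors \<open>a + t * b * (-1) ^ y i\<close>.\<close>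
  define P where "P = (\<lambda>k. real (n choose k) * x ^ k * (1 - x) ^ (n - k))"
  define Q where "Q = (\<lambda>k. (a ^ (n - k) * b ^ k) powr p * (t ^ k) powr p * K k)"
  have P: "P k = pmf (binomial_pmf n x) k" for k
    using x by (simp add: P_def)
  have P01: "0 \<le> P k" "P k \<le> 1" for k unfolding P by (auto simp: pmf_le_1)
  have K0: "K k \<ge> 0" for k by (simp add: K_def moment_nonneg)
  have abP: "(a ^ (n - k) * b ^ k) powr p * real (n choose k) powr (p / 2) = P k powr (p / 2)" for k
  proof -
    have "(a ^ (n - k) * b ^ k)\<^sup>2 = (a\<^sup>2) ^ (n - k) * (b\<^sup>2) ^ k"
      by (simp add: power_mult_distrib power_mult[symmetric] mult.commute)
    hence "(a ^ (n - k) * b ^ k)\<^sup>2 = (1 - x) ^ (n - k) * x ^ k"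
      using x by (simp add: a_def b_def)
    hence "(a ^ (n - k) * b ^ k) powr p = ((1 - x) ^ (n - k) * x ^ k) powr (p / 2)"
      using square_powr_half[of "a ^ (n - k) * b ^ k" p] ab by simp
    thus ?thesis by (simp add: P_def powr_mult mult_ac)
  qed
  have main: "L ^ n \<le> real (n + 1) powr p * (\<Sum>k\<le>n. Q k)"
  proof -
    have "(2 * L) ^ n = (\<Sum>y\<in>cube n. \<bar>\<Prod>i<n. a + t * b * (-1) ^ y i\<bar> powr p)"
    proof -
      have "2 * L = \<bar>a + t * b\<bar> powr p + \<bar>a - t * b\<bar> powr p" unfolding L a_def b_def by simp
      thus ?thesis unfolding sum_cube_prod_powr by (rule arg_cong)
    qed
    also have "\<dots> \<le> (\<Sum>y\<in>cube n. real (n + 1) powr p *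
        (\<Sum>k\<le>n. \<bar>a ^ (n - k) * (t * b) ^ k * krawchouk n k y\<bar> powr p))"
      unfolding prod_eq_sum_krawchouk using p by (intro sum_mono abs_sum_powr_le) auto
    also have "\<dots> = real (n + 1) powr p *
        (\<Sum>k\<le>n. \<Sum>y\<in>cube n. \<bar>a ^ (n - k) * (t * b) ^ k * krawchouk n k y\<bar> powr p)"
      unfolding sum_distrib_left[symmetric] by (subst sum.swap) (rule refl)
    also have "(\<Sum>k\<le>n. \<Sum>y\<in>cube n. \<bar>a ^ (n - k) * (t * b) ^ k * krawchouk n k y\<bar> powr p)
      = (\<Sum>k\<le>n. 2 ^ n * Q k)"
    proof (rule sum.cong[OF refl])
      fix k
      have "\<bar>a ^ (n - k) * (t * b) ^ k * krawchouk n k y\<bar> powr p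
        = (a ^ (n - k) * b ^ k) powr p * (t ^ k) powr p * \<bar>krawchouk n k y\<bar> powr p" for y
        using ab t by (simp add: abs_mult power_mult_distrib powr_mult)
      thus "(\<Sum>y\<in>cube n. \<bar>a ^ (n - k) * (t * b) ^ k * krawchouk n k y\<bar> powr p) = 2 ^ n * Q k"
        by (simp add: Q_def K_def moment_def sum_distrib_left[symmetric])
    qed
    finally have "2 ^ n * L ^ n \<le> 2 ^ n * (real (n + 1) powr p * (\<Sum>k\<le>n. Q k))"
      by (simp only: power_mult_distrib sum_distrib_left[symmetric] mult.left_commute)
    thus ?thesis by simp
  qed
  \<comment> \<open>The upper bound for degree \<open>k\<close>, rewritten by \<open>abP\<close>,
    gives \<open>L ^ n * P k powr (p / 2)\<close>; as \<open>P k \<le> 1\<close> and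
    \<open>p / 2 \<ge> 1\<close>, a single factor \<open>P k\<close> remains, which Hoeffding's
    inequality can sum over the tail.\<close>
  have QP: "Q k \<le> L ^ n * P k" for k
  proof -
    have "(t ^ k) powr p * K k \<le> L ^ n * real (n choose k) powr (p / 2)"
      using moment_homogeneous_le[OF p _ _ tp homogeneous_poly_krawchouk[of n k]] L0 t
      by (simp add: K_def moment_2_krawchouk)
    hence "(a ^ (n - k) * b ^ k) powr p * ((t ^ k) powr p * K k)
      \<le> (a ^ (n - k) * b ^ k) powr p * (L ^ n * real (n choose k) powr (p / 2))"
      by (intro mult_left_mono) auto
    also have "\<dots> = L ^ n * P k powr (p / 2)" unfolding abP[symmetric] by (simp add: mult_ac)
    also have "P k powr (p / 2) \<le> P k"
      using P01[of k] p powr_le_one_le[of "P k" "p / 2"] by (cases "P k = 0") auto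
    finally show ?thesis using L0 by (simp add: Q_def mult_ac mult_left_mono)
  qed
  define I where "I = {k. k \<le> n \<and> \<bar>real k - n * x\<bar> < W}"
  define J where "J = {k. k \<le> n \<and> \<bar>real k - n * x\<bar> \<ge> W}"
  have fin: "finite I" "finite J" by (auto simp: I_def J_def)
  have "(\<Sum>k\<in>J. P k) = measure_pmf.prob (binomial_pmf n x) J"
    unfolding P using fin by (simp add: measure_measure_pmf_finite)
  also have "\<dots> \<le> measure_pmf.prob (binomial_pmf n x) {k. \<bar>real k - real n * x\<bar> \<ge> W}"
    by (rule measure_pmf.finite_measure_mono) (auto simp: J_def)
  also have "\<dots> \<le> 2 * exp (-2 * W\<^sup>2 / n)"
    using x W n by (intro binomial_distribution.prob_abs_ge) (auto simp: binomial_distribution_def)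
  finally have PJ: "(\<Sum>k\<in>J. P k) \<le> 2 * exp (-2 * W\<^sup>2 / n)" .
  have "real (n + 1) powr p * (\<Sum>k\<in>J. Q k) \<le> real (n + 1) powr p * (L ^ n * (\<Sum>k\<in>J. P k))"
    unfolding sum_distrib_left using QP by (intro sum_mono mult_left_mono) auto
  also have "\<dots> \<le> real (n + 1) powr p * (L ^ n * (2 * exp (-2 * W\<^sup>2 / n)))"
    using PJ L0 by (intro mult_left_mono) auto
  also have "\<dots> = L ^ n * (real (n + 1) powr p * (2 * exp (-2 * W\<^sup>2 / n)))" by (simp add: mult_ac)
  also have "\<dots> \<le> L ^ n * (1 / 2)" using tail L0 by (intro mult_left_mono) auto
  finally have QJ: "real (n + 1) powr p * (\<Sum>k\<in>J. Q k) \<le> L ^ n / 2" by simp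
  have "{..n} = I \<union> J" "I \<inter> J = {}" by (auto simp: I_def J_def)
  hence "(\<Sum>k\<le>n. Q k) = (\<Sum>k\<in>I. Q k) + (\<Sum>k\<in>J. Q k)"
    using fin by (simp add: sum.union_disjoint)
  with main QJ have QI: "L ^ n / 2 \<le> real (n + 1) powr p * (\<Sum>k\<in>I. Q k)"
    by (simp add: distrib_left)
  \<comment> \<open>Pigeonhole over at most \<open>n + 1\<close> degrees that together carry at
    least half of \<open>L ^ n\<close>; the constant 4 instead of 2 makes the contradiction
    strict.\<close>
  have "\<exists>k\<in>I. L ^ n / (4 * real (n + 1) powr (p + 1)) \<le> Q k"
  proof (rule ccontr)
    assume "\<not> ?thesis"
    hence "(\<Sum>k\<in>I. Q k) \<le> real (card I) * (L ^ n / (4 * real (n + 1) powr (p + 1)))"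
      by (intro sum_bounded_above) auto
    also have "\<dots> \<le> real (n + 1) * (L ^ n / (4 * real (n + 1) powr (p + 1)))"
    proof (intro mult_right_mono)
      have "card I \<le> card {..n}" by (intro card_mono) (auto simp: I_def)
      thus "real (card I) \<le> real (n + 1)" by simp
    qed (use L0 in auto)
    also have "\<dots> = L ^ n / 4 / real (n + 1) powr p" by (simp add: powr_add)
    finally have "real (n + 1) powr p * (\<Sum>k\<in>I. Q k) \<le> L ^ n / 4"
      by (simp add: pos_le_divide_eq mult.commute)
    thus False using QI L0 zero_less_power[OF L0, of n] by linarith
  qed
  then obtain k where k: "k \<in> I" "L ^ n / (4 * real (n + 1) powr (p + 1)) \<le> Q k" by blast
  have "L ^ n \<le> 4 * real (n + 1) powr (p + 1) * Q k"
    using k(2) by (simp add: pos_divide_le_eq mult_ac)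
  hence "L ^ n * real (n choose k) powr (p / 2)
    \<le> 4 * real (n + 1) powr (p + 1) * Q k * real (n choose k) powr (p / 2)"
    by (intro mult_right_mono) auto
  also have "\<dots> = 4 * real (n + 1) powr (p + 1) * ((t ^ k) powr p * K k) * P k powr (p / 2)"
    unfolding abP[symmetric] by (simp add: Q_def mult_ac)
  also have "\<dots> \<le> 4 * real (n + 1) powr (p + 1) * ((t ^ k) powr p * K k) * 1"
    using P01[of k] p K0[of k] by (intro mult_left_mono powr_le1) auto
  finally show ?thesis using that[of k] k(1) by (simp add: K_def I_def mult_ac)
qed

section \<open>From moment bounds to the maximal ratio\<close>

lemma max_ratio_le:
  assumes "s \<le> n" "p > 0"
    and bd: "\<And>f. homogeneous_poly n s f \<Longrightarrow> moment n p f \<le> B * moment n 2 f powr (p / 2)"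
  shows "max_ratio n s p \<le> B"
  unfolding max_ratio_def
proof (rule cSUP_least)
  \<comment> \<open>The supremum must range over a nonempty set: \<open>krawchouk n s\<close> is a
    member because its second moment \<open>n choose s\<close> is positive.\<close>
  have "\<exists>y\<in>cube n. krawchouk n s y \<noteq> 0"
  proof (rule ccontr)
    assume "\<not> ?thesis"
    hence "moment n 2 (krawchouk n s) = 0" by (simp add: moment_def)
    thus False using assms(1) by (simp add: moment_2_krawchouk)
  qed
  thus "{f. homogeneous_poly n s f \<and> (\<exists>y\<in>cube n. f y \<noteq> 0)} \<noteq> {}"
    using homogeneous_poly_krawchouk by blast
next
  fix f assume "f \<in> {f. homogeneous_poly n s f \<and> (\<exists>y\<in>cube n. f y \<noteq> 0)}"
  then obtain y where f: "homogeneous_poly n s f" "y \<in> cube n" "f y \<noteq> 0" by blast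
  have "(\<Sum>y\<in>cube n. \<bar>f y\<bar> powr 2) > 0"
    using f by (intro sum_pos2[of _ y]) (auto simp: finite_cube)
  hence "moment n 2 f powr (p / 2) > 0" by (simp add: moment_def)
  thus "moment_ratio n p f \<le> B"
    using bd[OF f(1)] assms(2) by (simp add: moment_ratio_eq pos_divide_le_eq)
qed

lemma krawchouk_ratio_eq:
  assumes "p > 0"
  shows "krawchouk_ratio n s p = moment n p (krawchouk n s) / real (n choose s) powr (p / 2)"
  unfolding krawchouk_ratio_def using assms by (simp add: moment_ratio_eq moment_2_krawchouk)

lemma krawchouk_ratio_ge_1:
  assumes "p \<ge> 2" "s \<le> n"
  shows "krawchouk_ratio n s p \<ge> 1"
  using moment_2_le_moment[OF assms(1), of n "krawchouk n s"] assms
  by (simp add: krawchouk_ratio_eq moment_2_krawchouk)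

text \<open>The crude bound from Cauchy-Schwarz; it settles the degrees \<open>s \<le> W\<close> and
  the finitely many small dimensions.\<close>

lemma max_ratio_le_binomial:
  assumes "p \<ge> 2" "s \<le> n"
  shows "max_ratio n s p \<le> real (n choose s) powr (p / 2) * krawchouk_ratio n s p"
proof -
  have "max_ratio n s p \<le> real (n choose s) powr (p / 2)"
    using assms by (intro max_ratio_le moment_homogeneous_le_binomial) auto
  also have "\<dots> \<le> real (n choose s) powr (p / 2) * krawchouk_ratio n s p"
    using krawchouk_ratio_ge_1[OF assms] mult_left_mono[of 1 "krawchouk_ratio n s p" "real (n choose s) powr (p / 2)"]
    by simp
  finally show ?thesis .
qed

text \<open>The upper bound for degree \<open>s\<close> in dimension \<open>n\<close> is set against
  the lower bound for some Krawchouk polynomial of nearby degree \<open>k\<close> in the smaller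
  dimension \<open>m\<close>. The two differ by powers of \<open>t\<close>, \<open>L\<close> and a
  quotient of binomial coefficients, each at most a power of \<open>n\<close> with exponent of order
  \<open>W\<close>.\<close>

lemma max_ratio_le_krawchouk_ratio:
  fixes p :: real and n s W :: nat
  assumes p: "p \<ge> 2" and W: "W > 0" "2 * W < n" "W < s" and s: "2 * s \<le> n"
    and tail: "real (n + 1) powr p * (2 * exp (-2 * (real W)\<^sup>2 / n)) \<le> 1 / 2"
  shows "max_ratio n s p
    \<le> 4 * real (n + 1) powr (p + 1) * (real n ^ (5 * W)) powr p * krawchouk_ratio n s p"
proof -
  \<comment> \<open>Dropping \<open>2 W\<close> coordinates leaves room to move from the degree \<open>k\<close> found near \<open>m x = s - W\<close> up to \<open>s\<close>.\<close>
  define m where "m = n - 2 * W"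
  have m: "m > 0" "n = m + 2 * W" "m \<le> n" using W by (auto simp: m_def)
  define x where "x = (real s - real W) / real m"
  have mx: "real m * x = real s - real W" using m by (simp add: x_def)
  have x: "0 < x" "x \<le> 1 / 2" using W s m by (auto simp: x_def field_simps)
  have xn: "1 / real n \<le> x"
  proof -
    have "1 / real n \<le> 1 / real m" using m by (intro divide_left_mono) auto
    also have "\<dots> \<le> x" unfolding x_def using W m by (intro divide_right_mono) auto
    finally show ?thesis .
  qed
  obtain t L where t: "x \<le> t" "t \<le> 1"
    and Le: "L = (\<bar>sqrt (1 - x) + t * sqrt x\<bar> powr p + \<bar>sqrt (1 - x) - t * sqrt x\<bar> powr p) / 2"
    and tp: "two_point_bound p t L"
    using two_point_extremal[OF p x] by metis
  have t0: "t > 0" using t x by simp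
  have L0: "L \<ge> 1" using tp[unfolded two_point_bound_def, rule_format, of 1 0] by simp
  have L2: "L \<le> 2 powr p"
  proof -
    have "\<bar>sqrt (1 - x)\<bar> \<le> 1" "\<bar>t * sqrt x\<bar> \<le> 1"
      using x t t0 by (auto simp: abs_mult intro!: mult_le_one)
    hence "\<bar>sqrt (1 - x) + t * sqrt x\<bar> \<le> 2" "\<bar>sqrt (1 - x) - t * sqrt x\<bar> \<le> 2" by linarith+
    hence "\<bar>sqrt (1 - x) + t * sqrt x\<bar> powr p \<le> 2 powr p"
        "\<bar>sqrt (1 - x) - t * sqrt x\<bar> powr p \<le> 2 powr p"
      using p by (auto intro!: powr_mono2)
    thus ?thesis unfolding Le by simp
  qed
  have tail': "real (m + 1) powr p * (2 * exp (-2 * (real W)\<^sup>2 / m)) \<le> 1 / 2"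
  proof -
    have "2 * (real W)\<^sup>2 / n \<le> 2 * (real W)\<^sup>2 / m" using m by (intro divide_left_mono) auto
    hence "real (m + 1) powr p * (2 * exp (-2 * (real W)\<^sup>2 / m))
      \<le> real (n + 1) powr p * (2 * exp (-2 * (real W)\<^sup>2 / n))"
      using m p by (intro mult_mono powr_mono2) auto
    thus ?thesis using tail by simp
  qed
  obtain k where k: "k \<le> m" "\<bar>real k - m * x\<bar> < real W"
    "L ^ m * real (m choose k) powr (p / 2)
      \<le> 4 * real (m + 1) powr (p + 1) * (t ^ k) powr p * moment m p (krawchouk m k)"
    using krawchouk_moment_near_mean[OF p x t0 tp Le m(1) _ tail'] W by auto
  \<comment> \<open>As \<open>m * x = s - W\<close>, being within \<open>W\<close> of the mean puts
    \<open>k\<close> below \<open>s\<close>, and by at most \<open>2 * W\<close>.\<close>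
  have kr: "k \<le> s" "s - k \<le> 2 * W"
    using k(2) unfolding mx by linarith+
  define j where "j = s - k"
  have j: "s = k + j" "j \<le> 2 * W" using kr by (auto simp: j_def)
  define D where "D = real (n choose s) powr (p / 2)"
  define R where "R = krawchouk_ratio n s p"
  have D0: "D > 0" using s by (simp add: D_def)
  have R0: "R \<ge> 0" using krawchouk_ratio_ge_1[OF p, of s n] s by (simp add: R_def)
  have mom: "moment m p (krawchouk m k) \<le> D * R"
  proof -
    have "moment m p (krawchouk m k) \<le> moment n p (krawchouk n s)"
      using moment_krawchouk_mono[of p j "2 * W" m k] p j m by simp
    thus ?thesis using D0 p by (simp add: R_def D_def krawchouk_ratio_eq)
  qed
  have Dk: "D \<le> (real n ^ W) powr p * real (m choose k) powr (p / 2)"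
  proof -
    have "D \<le> (real n ^ (2 * W) * real (m choose k)) powr (p / 2)"
      unfolding D_def using binomial_shift_le[OF j(2) k(1)] m(2) j(1) p by (intro powr_mono2) auto
    also have "(real n ^ (2 * W)) = (real n ^ W)\<^sup>2" by (simp add: power_mult[symmetric] mult.commute)
    finally show ?thesis by (simp add: powr_mult square_powr_half)
  qed
  have LD: "L ^ m * D \<le> 4 * real (n + 1) powr (p + 1) * (t ^ k) powr p * (D * R) * (real n ^ W) powr p"
  proof -
    have "L ^ m * D \<le> L ^ m * ((real n ^ W) powr p * real (m choose k) powr (p / 2))"
      using Dk L0 by (intro mult_left_mono) auto
    also have "\<dots> = L ^ m * real (m choose k) powr (p / 2) * (real n ^ W) powr p" by (simp add: mult_ac)
    also have "\<dots> \<le> 4 * real (m + 1) powr (p + 1) * (t ^ k) powr p * moment m p (krawchouk m k) * (real n ^ W) powr p"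
      using k(3) by (intro mult_right_mono) auto
    also have "\<dots> \<le> 4 * real (n + 1) powr (p + 1) * (t ^ k) powr p * (D * R) * (real n ^ W) powr p"
      using mom m p t0 D0 R0 by (intro mult_mono powr_mono2) (auto simp: moment_nonneg)
    finally show ?thesis .
  qed
  hence Lm: "L ^ m \<le> 4 * real (n + 1) powr (p + 1) * (t ^ k) powr p * R * (real n ^ W) powr p"
    using D0 by (simp add: mult_ac mult_le_cancel_left_pos)
  \<comment> \<open>Each of the \<open>j\<close> missing factors \<open>t\<close> costs at most
    \<open>n\<close>, since \<open>1 / n \<le> x \<le> t\<close>.\<close>
  have tj: "1 \<le> (real n ^ (2 * W)) powr p * (t ^ j) powr p"
  proof -
    have nt: "1 \<le> real n * t" using mult_left_mono[OF order_trans[OF xn t(1)], of "real n"] m by simp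
    hence "1 \<le> (real n * t) ^ j" by (rule one_le_power)
    also have "\<dots> \<le> real n ^ (2 * W) * t ^ j"
      unfolding power_mult_distrib using m j t0 by (intro mult_right_mono power_increasing) auto
    finally have "1 powr p \<le> (real n ^ (2 * W) * t ^ j) powr p" using p by (intro powr_mono2) auto
    thus ?thesis by (simp add: powr_mult)
  qed
  have L2W: "L ^ (2 * W) \<le> (real n ^ (2 * W)) powr p"
  proof -
    have "L ^ (2 * W) \<le> (2 powr p) ^ (2 * W)" using L2 L0 by (intro power_mono) auto
    also have "\<dots> = (2 ^ (2 * W)) powr p"
      by (simp add: powr_realpow[symmetric] powr_powr mult.commute)
    also have "\<dots> \<le> (real n ^ (2 * W)) powr p"
      using W p by (intro powr_mono2 power_mono) auto
    finally show ?thesis .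
  qed
  have "moment n p f \<le> 4 * real (n + 1) powr (p + 1) * (real n ^ (5 * W)) powr p * R
      * moment n 2 f powr (p / 2)" if f: "homogeneous_poly n s f" for f
  proof -
    define N2 M2 E where "N2 = (real n ^ (2 * W)) powr p" and "M2 = moment n 2 f powr (p / 2)"
      and "E = 4 * real (n + 1) powr (p + 1) * R * (real n ^ W) powr p"
    have nn: "N2 \<ge> 0" "M2 \<ge> 0" "E \<ge> 0" using R0 by (auto simp: N2_def M2_def E_def)
    have tk: "(t ^ k) powr p > 0" using t0 by simp
    have LmE: "L ^ m \<le> (t ^ k) powr p * E" using Lm by (simp add: E_def mult_ac)
    \<comment> \<open>Inserting the factor from \<open>tj\<close> completes \<open>t ^ k\<close> to
      \<open>t ^ s\<close>, the power required by the upper bound in degree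
      \<open>s\<close>.\<close>
    have "(t ^ k) powr p * moment n p f * 1 \<le> (t ^ k) powr p * moment n p f * (N2 * (t ^ j) powr p)"
      unfolding N2_def using tj by (intro mult_left_mono) (auto simp: moment_nonneg)
    also have "\<dots> = N2 * ((t ^ s) powr p * moment n p f)"
      by (simp add: j(1) power_add powr_mult mult_ac)
    also have "\<dots> \<le> N2 * (L ^ n * M2)"
      using moment_homogeneous_le[OF p _ _ tp f] L0 t0 nn unfolding M2_def
      by (intro mult_left_mono) auto
    also have "\<dots> = N2 * (L ^ m * L ^ (2 * W) * M2)" by (simp add: m(2) power_add)
    also have "\<dots> \<le> N2 * ((t ^ k) powr p * E * N2 * M2)"
      using LmE L2W[folded N2_def] nn L0 t0
      by (intro mult_left_mono mult_right_mono mult_mono) auto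
    also have "\<dots> = (t ^ k) powr p * (E * N2 * N2 * M2)" by (simp add: mult_ac)
    finally have "moment n p f \<le> E * N2 * N2 * M2" using tk by simp
    \<comment> \<open>The exponent \<open>5 * W\<close> collects \<open>W\<close> from the binomial
      coefficients, where the power \<open>p / 2\<close> halves \<open>2 * W\<close>, and
      \<open>2 * W\<close> each from \<open>t\<close> and from \<open>L\<close>.\<close>
    also have "E * N2 * N2 = 4 * real (n + 1) powr (p + 1) * (real n ^ (5 * W)) powr p * R"
    proof -
      have "real n ^ (5 * W) = real n ^ W * real n ^ (2 * W) * real n ^ (2 * W)"
        by (simp add: power_add[symmetric])
      thus ?thesis by (simp add: E_def N2_def powr_mult mult_ac)
    qed
    finally show ?thesis by (simp add: M2_def)
  qed
  hence "max_ratio n s p \<le> 4 * real (n + 1) powr (p + 1) * (real n ^ (5 * W)) powr p * R"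
    using s p by (intro max_ratio_le) auto
  thus ?thesis by (simp add: R_def)
qed


text \<open>For \<open>W\<close> of order n^(3/4), W^2 / n is at least the square root of n, so the
  Hoeffding tail beats every power of n, while W log n is still of smaller order than n / log n.
  Hence all losses fit into the exponent with constant 1.\<close>

lemma max_ratio_le_eventually:
  fixes p :: real
  assumes p: "p \<ge> 2"
  shows "\<exists>N\<ge>2. \<forall>n\<ge>N. \<forall>s. 2 * s \<le> n \<longrightarrow>
    max_ratio n s p \<le> 2 powr (real n / log 2 (real n)) * krawchouk_ratio n s p"
proof -
  \<comment> \<open>In turn these conditions ensure room for dropping \<open>2 * W\<close>
    coordinates, the tail hypothesis, and the bound on the logarithm of the total loss
    \<open>F\<close>.\<close>
  have e1: "eventually (\<lambda>n. 2 * (real n powr (3 / 4) + 1) < real n) sequentially"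
    by real_asymp
  have e2: "eventually (\<lambda>n. real (n + 1) powr p * (2 * exp (-2 * real n powr (1 / 2))) \<le> 1 / 2) sequentially"
    using p by real_asymp
  have e3: "eventually (\<lambda>n. 2 + (p + 1) * log 2 (real (n + 1))
      + 5 * p * (real n powr (3 / 4) + 1) * log 2 (real n) \<le> real n / log 2 (real n)) sequentially"
    using p by real_asymp
  have "eventually (\<lambda>n. n \<ge> 2 \<and> (\<forall>s. 2 * s \<le> n \<longrightarrow>
    max_ratio n s p \<le> 2 powr (real n / log 2 (real n)) * krawchouk_ratio n s p)) sequentially"
    using e1 e2 e3 eventually_ge_at_top[of 2]
  proof eventually_elim
    case (elim n)
    define W where "W = nat \<lceil>real n powr (3 / 4)\<rceil>"
    have W: "real n powr (3 / 4) \<le> real W" "real W \<le> real n powr (3 / 4) + 1"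
      unfolding W_def using ceiling_correct[of "real n powr (3 / 4)"] by auto
    have "real n powr (3 / 4) > 0" using elim by simp
    hence W0: "W > 0" using W by linarith
    have "2 * real W \<le> 2 * (real n powr (3 / 4) + 1)" using W(2) by (rule mult_left_mono) simp
    also note elim(1)
    finally have "2 * real W < real n" .
    hence Wn: "2 * W < n" by linarith
    define F where "F = 4 * real (n + 1) powr (p + 1) * (real n ^ (5 * W)) powr p"
    have F: "F \<le> 2 powr (real n / log 2 (real n))"
    proof -
      have "log 2 F = 2 + (p + 1) * log 2 (real (n + 1)) + 5 * p * real W * log 2 (real n)"
        using elim log_pow_cancel[of 2 2]
        unfolding F_def by (simp add: log_mult log_powr log_nat_power)
      also have "\<dots> \<le> 2 + (p + 1) * log 2 (real (n + 1))
        + 5 * p * (real n powr (3 / 4) + 1) * log 2 (real n)"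
        using W p elim by (intro add_left_mono mult_right_mono mult_left_mono) auto
      also have "\<dots> \<le> real n / log 2 (real n)" using elim by simp
      finally have "log 2 F \<le> real n / log 2 (real n)" .
      moreover have "F > 0" using elim by (simp add: F_def)
      ultimately show ?thesis by (simp add: log_le_iff)
    qed
    have tail: "real (n + 1) powr p * (2 * exp (-2 * (real W)\<^sup>2 / n)) \<le> 1 / 2"
    proof -
      have "real n powr (1 / 2) = (real n powr (3 / 4))\<^sup>2 / real n"
      proof -
        have "(real n powr (3 / 4))\<^sup>2 = real n powr (3 / 2)"
          by (simp add: power2_eq_square powr_add[symmetric])
        also have "\<dots> = real n powr (1 / 2) * real n"
          using powr_add[of "real n" "1 / 2" 1] elim by simp
        finally show ?thesis using elim by simp
      qed
      also have "\<dots> \<le> (real W)\<^sup>2 / real n"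
        using W by (intro divide_right_mono power_mono) auto
      finally have "exp (-2 * (real W)\<^sup>2 / n) \<le> exp (-2 * real n powr (1 / 2))" by simp
      hence "real (n + 1) powr p * (2 * exp (-2 * (real W)\<^sup>2 / n))
        \<le> real (n + 1) powr p * (2 * exp (-2 * real n powr (1 / 2)))"
        by (intro mult_left_mono) auto
      thus ?thesis using elim by linarith
    qed
    have "max_ratio n s p \<le> 2 powr (real n / log 2 (real n)) * krawchouk_ratio n s p"
      if s: "2 * s \<le> n" for s
    proof -
      have "max_ratio n s p \<le> F * krawchouk_ratio n s p"
      proof (cases "W < s")
        case True
        show ?thesis unfolding F_def
          by (rule max_ratio_le_krawchouk_ratio[OF p W0 Wn True s tail])
      next
        case False
        \<comment> \<open>A degree \<open>s \<le> W\<close> is too small for the shift by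
          \<open>W\<close>, but here \<open>n choose s\<close> itself is at most
          \<open>n ^ W\<close>.\<close>
        have "real (n choose s) \<le> real (n ^ s)"
          using s by (intro of_nat_mono binomial_le_pow) auto
        also have "\<dots> \<le> real n ^ (5 * W)" using False elim by (auto intro!: power_increasing)
        finally have "real (n choose s) powr (p / 2) \<le> (real n ^ (5 * W)) powr (p / 2)"
          using p by (intro powr_mono2) auto
        also have "\<dots> \<le> (real n ^ (5 * W)) powr p"
          using p elim by (intro powr_mono) (auto intro!: one_le_power)
        also have "\<dots> \<le> F"
        proof -
          have "1 \<le> real (n + 1) powr (p + 1)" using p by (intro ge_one_powr_ge_zero) auto
          hence "1 * (real n ^ (5 * W)) powr p \<le> F"
            unfolding F_def by (intro mult_right_mono) auto
          thus ?thesis by simp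
        qed
        finally have "real (n choose s) powr (p / 2) * krawchouk_ratio n s p \<le> F * krawchouk_ratio n s p"
          using krawchouk_ratio_ge_1[OF p, of s n] s by (intro mult_right_mono) auto
        thus ?thesis using max_ratio_le_binomial[OF p, of s n] s by linarith
      qed
      also have "\<dots> \<le> 2 powr (real n / log 2 (real n)) * krawchouk_ratio n s p"
        using F krawchouk_ratio_ge_1[OF p, of s n] s by (intro mult_right_mono) auto
      finally show ?thesis .
    qed
    thus ?case using elim by blast
  qed
  then obtain N where "\<forall>n\<ge>N. n \<ge> 2 \<and> (\<forall>s. 2 * s \<le> n \<longrightarrow>
    max_ratio n s p \<le> 2 powr (real n / log 2 (real n)) * krawchouk_ratio n s p)"
    unfolding eventually_sequentially by blast
  thus ?thesis by (intro exI[of _ N]) auto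
qed

theorem theorem4p1:
  fixes p :: real
  assumes "p \<ge> 2"
  shows "\<exists>C::real. \<forall>n\<ge>2. \<forall>s::nat. real s \<le> real n / 2 \<longrightarrow>
           max_ratio n s p \<le> 2 powr (C * (real n / log 2 (real n))) * krawchouk_ratio n s p"
proof -
  obtain N where N: "N \<ge> 2" "\<forall>n\<ge>N. \<forall>s. 2 * s \<le> n \<longrightarrow>
    max_ratio n s p \<le> 2 powr (real n / log 2 (real n)) * krawchouk_ratio n s p"
    using max_ratio_le_eventually[OF assms] by blast
  \<comment> \<open>The value 1 serves \<open>n \<ge> N\<close>. Below \<open>N\<close>,
    \<open>n choose s\<close> is at most 2^n, and the exponent n p / 2 equals (p / 2) log n times n
    / log n.\<close>
  define C where "C = max 1 (p / 2 * log 2 (real N))"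
  have "max_ratio n s p \<le> 2 powr (C * (real n / log 2 (real n))) * krawchouk_ratio n s p"
    if n: "n \<ge> 2" and s: "real s \<le> real n / 2" for n s
  proof -
    have s': "2 * s \<le> n" "s \<le> n" using s by linarith+
    have r: "krawchouk_ratio n s p \<ge> 0" using krawchouk_ratio_ge_1[OF assms s'(2)] by simp
    have l: "log 2 (real n) > 0" using n by simp
    show ?thesis
    proof (cases "n \<ge> N")
      case True
      have "1 * (real n / log 2 (real n)) \<le> C * (real n / log 2 (real n))"
        using l by (intro mult_right_mono) (auto simp: C_def)
      hence "2 powr (real n / log 2 (real n)) * krawchouk_ratio n s p
        \<le> 2 powr (C * (real n / log 2 (real n))) * krawchouk_ratio n s p"
        using r by (intro mult_right_mono powr_mono) auto
      thus ?thesis using N(2) True s' by (meson order_trans)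
    next
      case False
      have "p / 2 * log 2 (real n) \<le> p / 2 * log 2 (real N)"
        using False n assms by (intro mult_left_mono) auto
      also have "\<dots> \<le> C" by (simp add: C_def)
      finally have "p / 2 * log 2 (real n) * (real n / log 2 (real n)) \<le> C * (real n / log 2 (real n))"
        using l by (intro mult_right_mono) auto
      hence le: "real n * (p / 2) \<le> C * (real n / log 2 (real n))" using l by (simp add: mult_ac)
      have "real (n choose s) \<le> real (2 ^ n)" by (intro of_nat_mono binomial_le_pow2)
      hence "real (n choose s) powr (p / 2) \<le> (2 powr real n) powr (p / 2)"
        using assms by (intro powr_mono2) (auto simp: powr_realpow)
      also have "\<dots> \<le> 2 powr (C * (real n / log 2 (real n)))"
        unfolding powr_powr using le by (intro powr_mono) auto
      finally have "real (n choose s) powr (p / 2) * krawchouk_ratio n s p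
        \<le> 2 powr (C * (real n / log 2 (real n))) * krawchouk_ratio n s p"
        using r by (rule mult_right_mono)
      thus ?thesis using max_ratio_le_binomial[OF assms s'(2)] by linarith
    qed
  qed
  thus ?thesis by blast
qed

end
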